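(* Let $\Bbbk$ be a field of characteristic zero, $n\in\mathbb N$, and $\psi_n\colon\mathcal F_n\mathfrak b\to\Bbbk$ a Lie algebra homomorphism. If $n=0$, then $M_{\psi_0}$ is irreducible if and only if $\psi_0(\mathcal V_0)\neq0$. If $n\ge1$, then $M_{\psi_n}$ is irreducible if and only if $\psi_n(\mathcal V_{2n})\neq0$ or $\psi_n(\mathcal V_{2n-1})\neq0$.
   Context: The centreless BCCA $\mathfrak b$ is the Lie algebra with basis $\{\mathcal U_n,\mathcal V_n\mid n\ge-1\}$ and brackets $[\mathcal U_n,\mathcal U_m]=(n-m)(\mathcal U_{n+m+2}-4\mathcal U_{n+m})$, $[\mathcal U_n,\mathcal V_m]=(n-m+1)\mathcal V_{n+m+2}-4(n-m)\mathcal V_{n+m}$, $[\mathcal V_n,\mathcal V_m]=0$ (symbols with index below $-1$ interpreted as $0$); it is isomorphic to the subalgebra of the centreless BMS$_3$ algebra spanned by $L_k-L_{-k}$ ($k\ge1$) and $M_k+M_{-k}$ ($k\ge0$). For $n\in\mathbb N$, $\mathcal F_n\mathfrak b=\mathrm{span}\{\mathcal U_k,\mathcal V_k\mid k\ge n\}$. For a Lie algebra homomorphism $\psi_n\colon\mathcal F_n\mathfrak b\to\Bbbk$, let $\Bbbk_{\psi_n}=\Bbbk1_{\psi_n}$ with $x\cdot1_{\psi_n}=\psi_n(x)1_{\psi_n}$, and $M_{\psi_n}=\mathrm{Ind}_{\mathcal F_n\mathfrak b}^{\mathfrak b}\Bbbk_{\psi_n}=U(\mathfrak b)\otimes_{U(\mathcal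 F_n\mathfrak b)}\Bbbk_{\psi_n}$. *)

theory Defs
  imports Main
begin

section \<open>The centreless BCCA b (basis U_k, V_k, k \<ge> -1)\<close>

datatype gen = U int | V int

fun gidx :: "gen \<Rightarrow> int" where
  "gidx (U k) = k" | "gidx (V k) = k"

definition validg :: "gen \<Rightarrow> bool" where
  "validg g \<longleftrightarrow> gidx g \<ge> -1"

definition inF :: "nat \<Rightarrow> gen \<Rightarrow> bool" where
  "inF n g \<longleftrightarrow> gidx g \<ge> int n"

text \<open>Elements of b are coordinate functions gen => k (finite support on valid
  generators). bas g is the basis vector g, and 0 if the index is below -1.\<close>
definition bas :: "gen \<Rightarrow> gen \<Rightarrow> 'k::field" where
  "bas g = (if validg g then (\<lambda>h. if h = g then 1 else 0) else (\<lambda>_. 0))"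

fun brk :: "gen \<Rightarrow> gen \<Rightarrow> gen \<Rightarrow> 'k::field" where
  "brk (U n) (U m) = (\<lambda>h. of_int (n - m) * (bas (U (n + m + 2)) h - 4 * bas (U (n + m)) h))"
| "brk (U n) (V m) = (\<lambda>h. of_int (n - m + 1) * bas (V (n + m + 2)) h
                            - 4 * of_int (n - m) * bas (V (n + m)) h)"
| "brk (V m) (U n) = (\<lambda>h. - (of_int (n - m + 1) * bas (V (n + m + 2)) h
                            - 4 * of_int (n - m) * bas (V (n + m)) h))"
| "brk (V n) (V m) = (\<lambda>_. 0)"

text \<open>A Lie algebra homomorphism psi : F_n b -> k is a linear map, determined by its
  values on the basis {U_k, V_k | k \<ge> n}; since k is abelian, the homomorphism
  condition is that psi vanishes on all brackets of basis elements of F_n b.\<close>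
definition lie_hom_F :: "nat \<Rightarrow> (gen \<Rightarrow> 'k::field) \<Rightarrow> bool" where
  "lie_hom_F n \<psi> \<longleftrightarrow>
     (\<forall>a b. validg a \<and> validg b \<and> inF n a \<and> inF n b \<longrightarrow>
        (\<Sum>g\<in>{g. brk a b g \<noteq> (0::'k)}. brk a b g * \<psi> g) = 0)"

definition tens :: "(gen list \<Rightarrow> 'k::field) set" where
  "tens = {f. finite {w. f w \<noteq> 0} \<and> (\<forall>w. f w \<noteq> 0 \<longrightarrow> (\<forall>g\<in>set w. validg g))}"

definition tmul :: "(gen list \<Rightarrow> 'k::field) \<Rightarrow> (gen list \<Rightarrow> 'k) \<Rightarrow> gen list \<Rightarrow> 'k" where
  "tmul f g = (\<lambda>w. \<Sum>i\<le>length w. f (take i w) * g (drop i w))"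

definition tadd :: "(gen list \<Rightarrow> 'k::field) \<Rightarrow> (gen list \<Rightarrow> 'k) \<Rightarrow> gen list \<Rightarrow> 'k" where
  "tadd f g = (\<lambda>w. f w + g w)"

definition tsub :: "(gen list \<Rightarrow> 'k::field) \<Rightarrow> (gen list \<Rightarrow> 'k) \<Rightarrow> gen list \<Rightarrow> 'k" where
  "tsub f g = (\<lambda>w. f w - g w)"

definition tsmul :: "'k::field \<Rightarrow> (gen list \<Rightarrow> 'k) \<Rightarrow> gen list \<Rightarrow> 'k" where
  "tsmul c f = (\<lambda>w. c * f w)"

definition mono :: "gen list \<Rightarrow> gen list \<Rightarrow> 'k::field" where
  "mono w = (\<lambda>u. if u = w then 1 else 0)"

definition emb :: "(gen \<Rightarrow> 'k::field) \<Rightarrow> gen list \<Rightarrow> 'k" where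
  "emb x = (\<lambda>w. case w of [g] \<Rightarrow> x g | _ \<Rightarrow> 0)"

definition lierel :: "gen \<Rightarrow> gen \<Rightarrow> gen list \<Rightarrow> 'k::field" where
  "lierel a b = tsub (tsub (mono [a, b]) (mono [b, a])) (emb (brk a b))"

section \<open>The induced module M_psi = U(b) \<otimes>_{U(F_n b)} k_psi = T(b) / J\<close>

text \<open>J = (two-sided ideal of T(b) defining U(b)) + (left ideal of T(b) generated by
  x - psi(x), x \<in> F_n b). Then U(b) \<otimes>_{U(F_n b)} k_psi = U(b)/U(b)(x - psi x) = T(b)/J.\<close>
inductive_set Jset :: "nat \<Rightarrow> (gen \<Rightarrow> 'k::field) \<Rightarrow> (gen list \<Rightarrow> 'k) set"
  for n :: nat and \<psi> :: "gen \<Rightarrow> 'k" where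
  zero: "(\<lambda>_. 0) \<in> Jset n \<psi>"
| add: "f \<in> Jset n \<psi> \<Longrightarrow> g \<in> Jset n \<psi> \<Longrightarrow> tadd f g \<in> Jset n \<psi>"
| smul: "f \<in> Jset n \<psi> \<Longrightarrow> tsmul c f \<in> Jset n \<psi>"
| lie: "p \<in> tens \<Longrightarrow> q \<in> tens \<Longrightarrow> validg a \<Longrightarrow> validg b \<Longrightarrow>
        tmul p (tmul (lierel a b) q) \<in> Jset n \<psi>"
| ind: "p \<in> tens \<Longrightarrow> validg a \<Longrightarrow> inF n a \<Longrightarrow>
        tmul p (tsub (mono [a]) (tsmul (\<psi> a) (mono []))) \<in> Jset n \<psi>"

definition cls :: "nat \<Rightarrow> (gen \<Rightarrow> 'k::field) \<Rightarrow> (gen list \<Rightarrow> 'k) \<Rightarrow> (gen list \<Rightarrow> 'k) set" where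
  "cls n \<psi> f = {g \<in> tens. tsub g f \<in> Jset n \<psi>}"

definition Mind :: "nat \<Rightarrow> (gen \<Rightarrow> 'k::field) \<Rightarrow> (gen list \<Rightarrow> 'k) set set" where
  "Mind n \<psi> = cls n \<psi> ` tens"

definition zeroM :: "nat \<Rightarrow> (gen \<Rightarrow> 'k::field) \<Rightarrow> (gen list \<Rightarrow> 'k) set" where
  "zeroM n \<psi> = cls n \<psi> (\<lambda>_. 0)"

definition addM :: "nat \<Rightarrow> (gen \<Rightarrow> 'k::field) \<Rightarrow> (gen list \<Rightarrow> 'k) set \<Rightarrow> (gen list \<Rightarrow> 'k) set
                      \<Rightarrow> (gen list \<Rightarrow> 'k) set" where
  "addM n \<psi> C D = {h \<in> tens. \<exists>f\<in>C. \<exists>g\<in>D. tsub h (tadd f g) \<in> Jset n \<psi>}"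

definition smulM :: "nat \<Rightarrow> (gen \<Rightarrow> 'k::field) \<Rightarrow> 'k \<Rightarrow> (gen list \<Rightarrow> 'k) set \<Rightarrow> (gen list \<Rightarrow> 'k) set" where
  "smulM n \<psi> c C = {h \<in> tens. \<exists>f\<in>C. tsub h (tsmul c f) \<in> Jset n \<psi>}"

definition actM :: "nat \<Rightarrow> (gen \<Rightarrow> 'k::field) \<Rightarrow> gen \<Rightarrow> (gen list \<Rightarrow> 'k) set \<Rightarrow> (gen list \<Rightarrow> 'k) set" where
  "actM n \<psi> a C = {h \<in> tens. \<exists>f\<in>C. tsub h (tmul (mono [a]) f) \<in> Jset n \<psi>}"

text \<open>b-submodules of M_psi (closure under the basis of b suffices by linearity).\<close>
definition submoduleM :: "nat \<Rightarrow> (gen \<Rightarrow> 'k::field) \<Rightarrow> (gen list \<Rightarrow> 'k) set set \<Rightarrow> bool" where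
  "submoduleM n \<psi> S \<longleftrightarrow> S \<subseteq> Mind n \<psi> \<and> zeroM n \<psi> \<in> S
     \<and> (\<forall>C\<in>S. \<forall>D\<in>S. addM n \<psi> C D \<in> S)
     \<and> (\<forall>c. \<forall>C\<in>S. smulM n \<psi> c C \<in> S)
     \<and> (\<forall>a. \<forall>C\<in>S. validg a \<longrightarrow> actM n \<psi> a C \<in> S)"

definition irreducible_ind :: "nat \<Rightarrow> (gen \<Rightarrow> 'k::field) \<Rightarrow> bool" where
  "irreducible_ind n \<psi> \<longleftrightarrow> Mind n \<psi> \<noteq> {zeroM n \<psi>}
     \<and> (\<forall>S. submoduleM n \<psi> S \<longrightarrow> S = {zeroM n \<psi>} \<or> S = Mind n \<psi>)"

end

theory Submission
  imports Complex_Main "HOL-Library.Function_Algebras" Defs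
begin

text \<open>
  A Lie homomorphism \<open>\<psi>\<close> on \<open>F\<^sub>n\<close> kills \<open>V\<^sub>k\<close> for \<open>k > 2n\<close>. Let \<open>m\<close> be the largest index with
  \<open>\<psi>(V\<^sub>m) \<noteq> 0\<close>.

  If \<open>m \<ge> 2n - 1\<close> (and \<open>m \<ge> n\<close>), a nonzero vector of a submodule is driven down to the cyclic vector:
  writing it as \<open>\<Sum> U\<^sub>i\<^sup>k f\<^sub>k\<close> with \<open>f\<^sub>k\<close> generated by the \<open>V\<^sub>l\<close> and the \<open>U\<^sub>j\<close> with \<open>j > i\<close>, the operator
  \<open>V\<^sub>m\<^sub>-\<^sub>i - \<psi>(V\<^sub>m\<^sub>-\<^sub>i)\<close> kills every \<open>f\<^sub>k\<close>, while its commutator with \<open>U\<^sub>i\<close> involves \<open>V\<^sub>m\<close> and is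
  injective on the \<open>f\<^sub>k\<close>; so it lowers the degree in \<open>U\<^sub>i\<close> by exactly one. This removes
  \<open>U\<^sub>-\<^sub>1, \<dots>, U\<^sub>n\<^sub>-\<^sub>1\<close> in turn, and then \<open>U\<^sub>m\<^sub>-\<^sub>i - \<psi>(U\<^sub>m\<^sub>-\<^sub>i)\<close> removes \<open>V\<^sub>-\<^sub>1, \<dots>, V\<^sub>n\<^sub>-\<^sub>1\<close>.

  Otherwise \<open>\<psi>\<close>, extended by \<open>V\<^sub>n\<^sub>-\<^sub>1 \<mapsto> 0\<close>, is still a character of \<open>F\<^sub>n + \<langle>V\<^sub>n\<^sub>-\<^sub>1\<rangle>\<close>, and the module
  induced from it is a proper quotient.

  That the modules in question are nonzero, and that the quotient is proper, is a
  Poincare-Birkhoff-Witt argument.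
\<close>

section \<open>Straightening words\<close>

text \<open>The value at \<open>[a, b]\<close> of the linear extension of \<open>F\<close>. No index check is needed: for valid
  \<open>a\<close> and \<open>b\<close>, the coefficient of a generator with index below \<open>-1\<close> is zero, and the formulas define
  a Lie algebra on all integer indices.\<close>
fun lie_comb :: "('k::field \<Rightarrow> 'e::ab_group_add \<Rightarrow> 'e) \<Rightarrow> gen \<Rightarrow> gen \<Rightarrow> (gen \<Rightarrow> 'e) \<Rightarrow> 'e" where
  "lie_comb s (U n) (U m) F = s (of_int (n - m)) (F (U (n + m + 2)) - s 4 (F (U (n + m))))"
| "lie_comb s (U n) (V m) F = s (of_int (n - m + 1)) (F (V (n + m + 2))) - s (4 * of_int (n - m)) (F (V (n + m)))"
| "lie_comb s (V m) (U n) F = - (s (of_int (n - m + 1)) (F (V (n + m + 2))) - s (4 * of_int (n - m)) (F (V (n + m))))"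
| "lie_comb s (V n) (V m) F = 0"

abbreviation lc :: "gen \<Rightarrow> gen \<Rightarrow> (gen \<Rightarrow> 'k::field) \<Rightarrow> 'k" where
  "lc \<equiv> lie_comb (*)"

section \<open>Identities for the bracket\<close>

lemma lc_add: "lc a b (\<lambda>g. F g + G g) = lc a b F + lc a b G"
  by (cases a; cases b) (simp_all add: algebra_simps)

lemma lc_diff: "lc a b (\<lambda>g. F g - G g) = lc a b F - lc a b G"
  by (cases a; cases b) (simp_all add: algebra_simps)

lemma lc_mult: "lc a b (\<lambda>g. c * F g) = c * lc a b F"
  by (cases a; cases b) (simp_all add: algebra_simps)

lemma lc_swap: "lc b a F = - lc a b F"
  by (cases a; cases b) (simp_all add: algebra_simps)

lemma lc_self: "lc a a F = 0"
  by (cases a) simp_all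

lemma lc_commute: "lc a b (\<lambda>g. lc c d (F g)) = lc c d (\<lambda>h. lc a b (\<lambda>g. F g h))"
  by (cases a; cases b; cases c; cases d) (simp_all add: algebra_simps)

lemma lc_jacobi:
  "lc a b (\<lambda>g. lc g c F) - lc a c (\<lambda>g. lc g b F) + lc b c (\<lambda>g. lc g a F) = 0"
  by (cases a; cases b; cases c) (simp_all add: algebra_simps)

text \<open>Interleaving the families as \<open>U (-1) < V (-1) < U 0 < V 0 < ...\<close> makes
  \<open>F_n\<close> the generators of key at least \<open>2 n\<close>, and lowering the threshold
  to \<open>2 n - 1\<close> adds exactly \<open>V (n - 1)\<close>. One construction thus serves both
  characters.\<close>

fun gen_key :: "gen \<Rightarrow> int" where
  "gen_key (U k) = 2 * k" | "gen_key (V k) = 2 * k + 1"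

lemma gen_key_eq_iff: "gen_key a = gen_key b \<longleftrightarrow> a = b"
  by (cases a; cases b) (auto, presburger+)

fun inversions :: "gen list \<Rightarrow> nat" where
  "inversions [] = 0"
| "inversions (x # xs) = length (filter (\<lambda>y. gen_key y < gen_key x) xs) + inversions xs"

lemma inversions_swap:
  "gen_key b < gen_key a \<Longrightarrow> inversions (u @ a # b # v) = Suc (inversions (u @ b # a # v))"
  by (induction u) auto

definition descent :: "gen list \<Rightarrow> gen list \<times> gen \<times> gen \<times> gen list \<Rightarrow> bool" where
  "descent w d = (case d of (u, a, b, v) \<Rightarrow> w = u @ a # b # v \<and> gen_key b < gen_key a)"

lemma descent_exists: "\<not> sorted (map gen_key w) \<Longrightarrow> \<exists>d. descent w d"
proof (induction w)
  case (Cons x w)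
  show ?case
  proof (cases "sorted (map gen_key w)")
    case True
    with Cons.prems obtain y w' where w: "w = y # w'" by (cases w) auto
    with Cons.prems True have "gen_key y < gen_key x" by force
    with w show ?thesis by (intro exI[of _ "([], x, y, w')"]) (simp add: descent_def)
  next
    case False
    with Cons.IH obtain u a b v where "descent w (u, a, b, v)" by fast
    then show ?thesis
      by (intro exI[of _ "(x # u, a, b, v)"]) (simp add: descent_def)
  qed
qed simp

text \<open>An arbitrary choice; by \<open>descents_confluent\<close> the value of
  \<open>straighten\<close> does not depend on it.\<close>

definition some_descent :: "gen list \<Rightarrow> gen list \<times> gen \<times> gen \<times> gen list" where
  "some_descent w = (SOME d. descent w d)"

lemma some_descentD:
  assumes "\<not> sorted (map gen_key w)" "some_descent w = (u, a, b, v)"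
  shows "w = u @ a # b # v" "gen_key b < gen_key a"
proof -
  have "descent w (some_descent w)"
    unfolding some_descent_def using descent_exists[OF assms(1)] by (rule someI_ex)
  then show "w = u @ a # b # v" "gen_key b < gen_key a"
    using assms(2) by (simp_all add: descent_def)
qed

lemma some_descent_less:
  assumes "\<not> sorted (map gen_key w)" "(u, a, b, v) = some_descent w"
  shows "length w = length (u @ g # v) + 1" "inversions (u @ b # a # v) < inversions w"
  using some_descentD[OF assms(1) assms(2)[symmetric]] by (simp_all add: inversions_swap)

text \<open>Linear extension of \<open>\<theta>\<close> from sorted words to all words by rewriting \<open>ab = ba + [a, b]\<close>.\<close>
function straighten :: "(gen list \<Rightarrow> 'k::field) \<Rightarrow> gen list \<Rightarrow> 'k" where
  "straighten \<theta> w = (if sorted (map gen_key w) then \<theta> w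
     else case some_descent w of (u, a, b, v) \<Rightarrow>
       straighten \<theta> (u @ b # a # v) + lc a b (\<lambda>g. straighten \<theta> (u @ g # v)))"
  by pat_completeness auto
termination
proof (relation "measures [\<lambda>(\<theta>, w). length w, \<lambda>(\<theta>, w). inversions w]", goal_cases)
  case 2
  then show ?case using some_descent_less by force
next
  case 3
  then show ?case using some_descent_less by force
qed simp

declare straighten.simps [simp del]

lemma straighten_sorted: "sorted (map gen_key w) \<Longrightarrow> straighten \<theta> w = \<theta> w"
  by (simp add: straighten.simps)

section \<open>Confluence of straightening\<close>

definition word_less :: "(gen list \<times> gen list) set" where
  "word_less = measures [length, inversions]"

lemma wf_word_less: "wf word_less"
  by (simp add: word_less_def)

lemma word_less_shorter: "length x < length y \<Longrightarrow> (x, y) \<in> word_less"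
  by (simp add: word_less_def)

lemma word_less_swap: "gen_key b < gen_key a \<Longrightarrow> (u @ b # a # v, u @ a # b # v) \<in> word_less"
  by (simp add: word_less_def inversions_swap)

lemma trans_word_less: "(x, y) \<in> word_less \<Longrightarrow> (y, z) \<in> word_less \<Longrightarrow> (x, z) \<in> word_less"
  by (auto simp: word_less_def)

definition commutes_at :: "(gen list \<Rightarrow> 'k::field) \<Rightarrow> gen list \<Rightarrow> gen \<Rightarrow> gen \<Rightarrow> gen list \<Rightarrow> bool" where
  "commutes_at \<sigma> u a b v \<longleftrightarrow>
     \<sigma> (u @ a # b # v) = \<sigma> (u @ b # a # v) + lc a b (\<lambda>g. \<sigma> (u @ g # v))"

lemma commutes_at_swap: "commutes_at \<sigma> u a b v \<Longrightarrow> commutes_at \<sigma> u b a v"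
  by (simp add: commutes_at_def lc_swap[of b a])

text \<open>The diamond lemma: two descents of one word give the same value. Overlapping descents
  are resolved by the Jacobi identity.\<close>
lemma descents_confluent:
  fixes \<sigma> :: "gen list \<Rightarrow> 'k::field"
  assumes IH: "\<And>u a b v. (u @ a # b # v, w) \<in> word_less \<Longrightarrow> gen_key b < gen_key a \<Longrightarrow> commutes_at \<sigma> u a b v"
    and w: "w = u @ a # b # v" "gen_key b < gen_key a"
    and w': "w = u' @ a' # b' # v'" "gen_key b' < gen_key a'"
    and len: "length u < length u'"
  shows "\<sigma> (u @ b # a # v) + lc a b (\<lambda>g. \<sigma> (u @ g # v)) =
         \<sigma> (u' @ b' # a' # v') + lc a' b' (\<lambda>g. \<sigma> (u' @ g # v'))"
proof -
  \<comment> \<open>In words shorter than \<open>w\<close> the two letters may come in any order: an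
    ascent is a swapped descent, and equal letters have zero bracket.\<close>
  have short: "\<sigma> (u @ a # b # v) = \<sigma> (u @ b # a # v) + lc a b (\<lambda>g. \<sigma> (u @ g # v))"
    if "length (u @ a # b # v) < length w" for u a b v
  proof (cases "gen_key a" "gen_key b" rule: linorder_cases)
    case less
    then have "commutes_at \<sigma> u b a v" using that by (intro IH word_less_shorter) auto
    from commutes_at_swap[OF this] show ?thesis by (simp add: commutes_at_def)
  next
    case equal
    then show ?thesis by (simp add: gen_key_eq_iff lc_self)
  next
    case greater
    then show ?thesis using that IH[OF word_less_shorter] by (auto simp: commutes_at_def)
  qed
  have step: "\<sigma> (u @ a # b # v) = \<sigma> (u @ b # a # v) + lc a b (\<lambda>g. \<sigma> (u @ g # v))"
    if "(u @ a # b # v, w) \<in> word_less" "gen_key b < gen_key a" for u a b v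
    using IH[OF that] by (simp add: commutes_at_def)
  obtain x where u': "u' = u @ x" and x: "x @ a' # b' # v' = a # b # v" "x \<noteq> []"
    using w(1) w'(1) len by (auto simp: append_eq_append_conv2)
  then obtain y where y: "x = a # y" by (cases x) auto
  show ?thesis
  \<comment> \<open>\<open>y\<close> is the part of \<open>u'\<close> after \<open>u @ [a]\<close>.
    If it is empty, the two descents overlap in \<open>b\<close>; otherwise they are disjoint, and
    the two rewritings commute.\<close>
  proof (cases y)
    case Nil
    let ?c = b'
    have eq: "a' = b" "v = ?c # v'" "u' = u @ [a]" using Nil y x u' by auto
    have lt: "gen_key b < gen_key a" "gen_key ?c < gen_key b" "gen_key ?c < gen_key a" using w(2) w'(2) eq by auto
    have w_eq: "w = u @ a # b # ?c # v'" using w eq by simp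
    have 1: "(u @ b # a # ?c # v', w) \<in> word_less" using w_eq word_less_swap lt by simp
    have 2: "(u @ b # ?c # a # v', w) \<in> word_less"
      using trans_word_less[OF word_less_swap[of ?c a "u @ [b]" v'] ] 1 lt by simp
    have 3: "(u @ a # ?c # b # v', w) \<in> word_less"
      using w_eq word_less_swap[of ?c b "u @ [a]"] lt by simp
    have 4: "(u @ ?c # a # b # v', w) \<in> word_less"
      using trans_word_less[OF word_less_swap[of ?c a u] ] 3 lt by simp
    have A: "\<sigma> (u @ b # a # ?c # v') = \<sigma> (u @ b # ?c # a # v') + lc a ?c (\<lambda>g. \<sigma> (u @ b # g # v'))"
      using step[of "u @ [b]" a ?c v'] 1 lt by simp
    have B: "\<sigma> (u @ b # ?c # a # v') = \<sigma> (u @ ?c # b # a # v') + lc b ?c (\<lambda>g. \<sigma> (u @ g # a # v'))"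
      using step[OF 2] lt by simp
    have C: "\<sigma> (u @ a # ?c # b # v') = \<sigma> (u @ ?c # a # b # v') + lc a ?c (\<lambda>g. \<sigma> (u @ g # b # v'))"
      using step[OF 3] lt by simp
    have D: "\<sigma> (u @ ?c # a # b # v') = \<sigma> (u @ ?c # b # a # v') + lc a b (\<lambda>g. \<sigma> (u @ ?c # g # v'))"
      using step[of "u @ [?c]" a b v'] 4 lt by simp
    \<comment> \<open>These words have one letter fewer than \<open>w\<close>, so
      \<open>short\<close> applies; the leftover terms of the two reductions become nested
      brackets.\<close>
    have sh: "\<sigma> (u @ g # c # v') - \<sigma> (u @ c # g # v') = lc g c (\<lambda>h. \<sigma> (u @ h # v'))" for g c
      using short[of u g c v'] w_eq by simp
    have J: "lc a b (\<lambda>g. \<sigma> (u @ g # ?c # v') - \<sigma> (u @ ?c # g # v'))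
      - lc a ?c (\<lambda>g. \<sigma> (u @ g # b # v') - \<sigma> (u @ b # g # v'))
      + lc b ?c (\<lambda>g. \<sigma> (u @ g # a # v') - \<sigma> (u @ a # g # v')) = 0"
      unfolding sh by (rule lc_jacobi)
    show ?thesis using J unfolding lc_diff by (simp add: eq A B C D algebra_simps)
  next
    case (Cons z x')
    then have eq: "z = b" "v = x' @ a' # b' # v'" "u' = u @ a # b # x'" using y x u' by auto
    let ?P = "\<lambda>p q. u @ p @ x' @ q @ v'"
    have w_eq: "w = ?P [a, b] [a', b']" using w eq by simp
    have 1: "(u @ b # a # x' @ a' # b' # v', w) \<in> word_less" using w_eq word_less_swap w(2) by simp
    have 2: "(u @ a # b # x' @ b' # a' # v', w) \<in> word_less"
      using w_eq word_less_swap[of b' a' "u @ a # b # x'" v'] w'(2) by simp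
    have A: "\<sigma> (u @ b # a # x' @ a' # b' # v') = \<sigma> (u @ b # a # x' @ b' # a' # v')
        + lc a' b' (\<lambda>h. \<sigma> (u @ b # a # x' @ h # v'))"
      using step[of "u @ b # a # x'" a' b' v'] 1 w'(2) by simp
    have B: "\<sigma> (u @ a # b # x' @ b' # a' # v') = \<sigma> (u @ b # a # x' @ b' # a' # v')
        + lc a b (\<lambda>g. \<sigma> (u @ g # x' @ b' # a' # v'))"
      using step[OF 2] w(2) by simp
    have C: "\<sigma> (u @ g # x' @ a' # b' # v') = \<sigma> (u @ g # x' @ b' # a' # v')
        + lc a' b' (\<lambda>h. \<sigma> (u @ g # x' @ h # v'))" for g
      using short[of "u @ g # x'" a' b' v'] w_eq by simp
    have D: "\<sigma> (u @ a # b # x' @ h # v') = \<sigma> (u @ b # a # x' @ h # v')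
        + lc a b (\<lambda>g. \<sigma> (u @ g # x' @ h # v'))" for h
      using short[of u a b "x' @ h # v'"] w_eq by simp
    show ?thesis
      using lc_commute[of a b a' b' "\<lambda>g h. \<sigma> (u @ g # x' @ h # v')"]
      by (simp add: eq A B C D lc_add algebra_simps)
  qed
qed

text \<open>The recursion defines the value through the chosen descent; confluence, available from
  the induction hypothesis, transfers it to the given one.\<close>

lemma straighten_descent:
  assumes "gen_key b < gen_key a"
  shows "commutes_at (straighten \<theta>) u a b v"
  using assms
proof (induction "u @ a # b # v" arbitrary: u a b v rule: wf_induct_rule[OF wf_word_less])
  case (1 u a b v)
  let ?w = "u @ a # b # v" and ?\<sigma> = "straighten \<theta>"
  have ns: "\<not> sorted (map gen_key ?w)" using 1(2) by (auto simp: sorted_append)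
  obtain u' a' b' v' where d: "some_descent ?w = (u', a', b', v')" by (cases "some_descent ?w")
  note w' = some_descentD[OF ns d]
  have val: "?\<sigma> ?w = ?\<sigma> (u' @ b' # a' # v') + lc a' b' (\<lambda>g. ?\<sigma> (u' @ g # v'))"
    by (subst straighten.simps) (simp add: ns d del: map_append)
  note conf = descents_confluent[where w = ?w and \<sigma> = ?\<sigma>]
  consider "length u < length u'" | "length u = length u'" | "length u' < length u" by linarith
  then have "?\<sigma> (u @ b # a # v) + lc a b (\<lambda>g. ?\<sigma> (u @ g # v)) =
         ?\<sigma> (u' @ b' # a' # v') + lc a' b' (\<lambda>g. ?\<sigma> (u' @ g # v'))"
  proof cases
    case 1
    show ?thesis by (rule conf[OF "1.hyps" refl "1.prems" w' 1]) auto
  next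
    case 2
    with w'(1) show ?thesis by simp
  next
    case 3
    show ?thesis by (rule conf[OF "1.hyps" w' refl "1.prems" 3, symmetric]) auto
  qed
  with val show ?case by (simp add: commutes_at_def)
qed

lemma straighten_commutator:
  "straighten \<theta> (u @ a # b # v) = straighten \<theta> (u @ b # a # v) + lc a b (\<lambda>g. straighten \<theta> (u @ g # v))"
proof (cases "gen_key a" "gen_key b" rule: linorder_cases)
  case less
  then show ?thesis using commutes_at_swap[OF straighten_descent] by (auto simp: commutes_at_def)
next
  case equal
  then show ?thesis by (simp add: gen_key_eq_iff lc_self)
next
  case greater
  then show ?thesis using straighten_descent by (auto simp: commutes_at_def)
qed

section \<open>Functionals given by PBW monomials\<close>

text \<open>In a sorted word the letters of key at least \<open>t\<close> form a suffix. They are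
  evaluated by \<open>\<psi>\<close> and the rest by \<open>\<tau>\<close>: for a character
  \<open>\<psi>\<close> this is the functional on the induced module with values
  \<open>\<tau>\<close> on its PBW basis.\<close>

definition induced_form :: "int \<Rightarrow> (gen \<Rightarrow> 'k::field) \<Rightarrow> (gen list \<Rightarrow> 'k) \<Rightarrow> gen list \<Rightarrow> 'k" where
  "induced_form t \<psi> \<tau> = straighten (\<lambda>w. \<tau> (filter (\<lambda>g. gen_key g < t) w) *
      prod_list (map \<psi> (filter (\<lambda>g. t \<le> gen_key g) w)))"

text \<open>As \<open>F\<close> is arbitrary below \<open>t\<close>, the bracket of \<open>a\<close>
  and \<open>b\<close> can involve only keys from \<open>t\<close> on. So this says at once that
  these generators span a subalgebra and that \<open>\<psi>\<close> is a character of it.\<close>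

definition character_above :: "int \<Rightarrow> (gen \<Rightarrow> 'k::field) \<Rightarrow> bool" where
  "character_above t \<psi> \<longleftrightarrow> (\<forall>a b F. t \<le> gen_key a \<longrightarrow> t \<le> gen_key b \<longrightarrow>
     (\<forall>g. t \<le> gen_key g \<longrightarrow> F g = \<psi> g) \<longrightarrow> lc a b F = 0)"

text \<open>Induction along \<open>word_less\<close>. A descent inside \<open>w\<close> is rewritten
  on both sides; for sorted \<open>w @ [b]\<close> the definition applies; if only the last letter
  of \<open>w\<close> exceeds \<open>b\<close>, swapping them costs a bracket of two letters of key
  at least \<open>t\<close>, which the character kills.\<close>

lemma induced_form_snoc:
  assumes \<psi>: "character_above t \<psi>" and b: "t \<le> gen_key b"
  shows "induced_form t \<psi> \<tau> (w @ [b]) = \<psi> b * induced_form t \<psi> \<tau> w"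
  using b
proof (induction "w @ [b]" arbitrary: w b rule: wf_induct_rule[OF wf_word_less])
  case (1 w b)
  let ?\<sigma> = "induced_form t \<psi> \<tau>"
  have comm: "?\<sigma> (u @ a # b # v) = ?\<sigma> (u @ b # a # v) + lc a b (\<lambda>g. ?\<sigma> (u @ g # v))" for u a b v
    unfolding induced_form_def by (rule straighten_commutator)
  have IH: "?\<sigma> (x @ [c]) = \<psi> c * ?\<sigma> x" if "(x @ [c], w @ [b]) \<in> word_less" "t \<le> gen_key c" for x c
    using 1(1)[OF that] .
  consider "\<not> sorted (map gen_key w)" | "sorted (map gen_key (w @ [b]))"
    | "sorted (map gen_key w)" "\<not> sorted (map gen_key (w @ [b]))" by blast
  then show ?case
  proof cases
    case 1
    then obtain u a c v where w: "w = u @ a # c # v" and lt: "gen_key c < gen_key a"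
      using descent_exists[of w] by (auto simp: descent_def)
    have "(u @ c # a # v @ [b], w @ [b]) \<in> word_less"
      using word_less_swap[OF lt, of u "v @ [b]"] w by simp
    then have 2: "?\<sigma> (u @ c # a # v @ [b]) = \<psi> b * ?\<sigma> (u @ c # a # v)"
      using IH[of "u @ c # a # v" b] \<open>t \<le> gen_key b\<close> by simp
    have 3: "?\<sigma> (u @ g # v @ [b]) = \<psi> b * ?\<sigma> (u @ g # v)" for g
      using IH[of "u @ g # v" b] \<open>t \<le> gen_key b\<close> w by (simp add: word_less_shorter)
    show ?thesis
      unfolding w using comm[of u a c "v @ [b]"] comm[of u a c v]
      by (simp add: 2 3 lc_mult algebra_simps)
  next
    case 2
    then have "sorted (map gen_key w)" by (simp add: sorted_append)
    with 2 show ?thesis using \<open>t \<le> gen_key b\<close> unfolding induced_form_def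
      by (simp add: straighten_sorted del: map_append) simp
  next
    case 3
    then obtain w' c where w: "w = w' @ [c]" by (cases w rule: rev_cases) auto
    have lt: "gen_key b < gen_key c" using 3 unfolding w by (fastforce simp: sorted_append)
    then have c: "t \<le> gen_key c" using \<open>t \<le> gen_key b\<close> by simp
    have eq: "?\<sigma> (w' @ [g]) = \<psi> g * ?\<sigma> w'" if "t \<le> gen_key g" for g
      using IH[of w', OF _ that] w by (simp add: word_less_shorter)
    have "?\<sigma> (w' @ [b, c]) = \<psi> c * ?\<sigma> (w' @ [b])"
      using IH[of "w' @ [b]" c] c word_less_swap[OF lt, of w' "[]"] w by simp
    moreover have "lc c b (\<lambda>g. ?\<sigma> (w' @ [g])) = 0"
    proof -
      let ?F = "\<lambda>g. if t \<le> gen_key g then \<psi> g else 0"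
      have z: "lc c b (\<lambda>g. if t \<le> gen_key g then \<psi> g else G g) = 0" for G
        using \<psi>[unfolded character_above_def, rule_format, OF c \<open>t \<le> gen_key b\<close>] by simp
      show ?thesis
      \<comment> \<open>\<open>z\<close> needs a function equal to \<open>\<psi>\<close> above
        \<open>t\<close>, but the values here carry the factor \<open>?\<sigma> w'\<close>. Divide
        by it, or, if it is zero, write the function as a difference of two such functions.\<close>
      proof (cases "?\<sigma> w' = 0")
        case True
        have "lc c b (\<lambda>g. (if t \<le> gen_key g then \<psi> g else ?\<sigma> (w' @ [g])) 
           - (if t \<le> gen_key g then \<psi> g else 0)) = 0" unfolding lc_diff z by simp
        moreover have "(\<lambda>g. (if t \<le> gen_key g then \<psi> g else ?\<sigma> (w' @ [g])) 
           - (if t \<le> gen_key g then \<psi> g else 0)) = (\<lambda>g. ?\<sigma> (w' @ [g]))"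
          using True eq by auto
        ultimately show ?thesis by simp
      next
        case False
        have "(\<lambda>g. ?\<sigma> (w' @ [g])) = (\<lambda>g. ?\<sigma> w' * (if t \<le> gen_key g then \<psi> g else ?\<sigma> (w' @ [g]) / ?\<sigma> w'))"
          using False eq by auto
        then show ?thesis using z by (simp add: lc_mult)
      qed
    qed
    ultimately show ?thesis using comm[of w' c b "[]"] w eq[OF c] eq[OF \<open>t \<le> gen_key b\<close>] by simp
  qed
qed

section \<open>Lowering operators\<close>

context vector_space
begin

lemma lie_comb_in_subspace:
  assumes W: "subspace W"
  shows "n \<noteq> m \<Longrightarrow> F (U (n + m + 2)) \<in> W \<Longrightarrow> F (U (n + m)) \<in> W \<Longrightarrow> lie_comb scale (U n) (U m) F \<in> W"
    and "F (V (n + m + 2)) \<in> W \<Longrightarrow> (n \<noteq> m \<Longrightarrow> F (V (n + m)) \<in> W) \<Longrightarrow> lie_comb scale (U n) (V m) F \<in> W"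
    and "F (V (n + m + 2)) \<in> W \<Longrightarrow> (n \<noteq> m \<Longrightarrow> F (V (n + m)) \<in> W) \<Longrightarrow> lie_comb scale (V m) (U n) F \<in> W"
  by (cases "n = m"; auto intro!: subspace_scale[OF W] subspace_diff[OF W] subspace_neg[OF W])+

text \<open>For linear \<open>G\<close> and a subspace \<open>N\<close>: the sums
  \<open>f_0 + G f_1 + ... + G^(k-1) f_(k-1)\<close> with all \<open>f_j\<close> in
  \<open>N\<close>, that is, degree less than \<open>k\<close> in \<open>G\<close>. The shift by one
  makes level 0 the zero space.\<close>

fun op_filtration :: "('b \<Rightarrow> 'b) \<Rightarrow> 'b set \<Rightarrow> nat \<Rightarrow> 'b set" where
  "op_filtration G N 0 = {0}"
| "op_filtration G N (Suc k) = {G x + y | x y. x \<in> op_filtration G N k \<and> y \<in> N}"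

end

locale op_filtered = vector_space scale
  for scale :: "'k::field_char_0 \<Rightarrow> 'e::ab_group_add \<Rightarrow> 'e" (infixr "*s" 75) +
  fixes G :: "'e \<Rightarrow> 'e" and N :: "'e set"
  assumes linear_G: "Vector_Spaces.linear scale scale G"
    and subspace_N: "subspace N"
begin

abbreviation filt :: "nat \<Rightarrow> 'e set" where "filt \<equiv> op_filtration G N"

interpretation G: Vector_Spaces.linear scale scale G by (rule linear_G)

lemma zero_N: "0 \<in> N"
  using subspace_N by (rule subspace_0)

lemma subspace_filt: "subspace (filt k)"
proof (induction k)
  case 0
  then show ?case by (simp add: subspace_def)
next
  case (Suc k)
  have "filt (Suc k) = {a + b | a b. a \<in> G ` filt k \<and> b \<in> N}" by auto
  then show ?case
    using subspace_sums[OF G.subspace_image[OF Suc] subspace_N] by simp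
qed

lemma filt_SucI2: "x \<in> filt k \<Longrightarrow> y \<in> N \<Longrightarrow> G x + y \<in> filt (Suc k)"
  by (subst op_filtration.simps) blast

lemma filt_G: "x \<in> filt k \<Longrightarrow> G x \<in> filt (Suc k)"
  using filt_SucI2[OF _ zero_N] by (metis add.right_neutral)

lemma N_filt: "x \<in> N \<Longrightarrow> x \<in> filt (Suc k)"
  using filt_SucI2[OF subspace_0[OF subspace_filt]] by (metis G.zero add_0)

lemma filt_SucE:
  assumes "x \<in> filt (Suc k)"
  obtains a b where "a \<in> filt k" "b \<in> N" "x = G a + b"
  using assms by (subst (asm) op_filtration.simps) blast

lemma filt_SucI: "x \<in> filt k \<Longrightarrow> x \<in> filt (Suc k)"
proof (induction k arbitrary: x)
  case 0
  then show ?case using N_filt[OF zero_N, of 0] by (simp del: op_filtration.simps(2))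
next
  case (Suc k)
  from Suc.prems obtain a b where "a \<in> filt k" "b \<in> N" "x = G a + b" by (rule filt_SucE)
  then show ?case using filt_SucI2 Suc.IH by blast
qed

lemma funpow_G_filt: "f \<in> N \<Longrightarrow> (G ^^ k) f \<in> filt (Suc k)"
proof (induction k)
  case 0
  then show ?case using N_filt[of f 0] by simp
next
  case (Suc k)
  then show ?case using filt_G[of "(G ^^ k) f" "Suc k"] by simp
qed

lemma filt_leading:
  "x \<in> filt (Suc k) \<Longrightarrow> \<exists>f\<in>N. \<exists>y\<in>filt k. x = (G ^^ k) f + y"
proof (induction k arbitrary: x)
  case 0
  then show ?case by (auto simp: G.zero)
next
  case (Suc k)
  from Suc.prems obtain z h where z: "z \<in> filt (Suc k)" and h: "h \<in> N" and x: "x = G z + h"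
    by (rule filt_SucE)
  from Suc.IH[OF z] obtain f y where f: "f \<in> N" "y \<in> filt k" "z = (G ^^ k) f + y" by blast
  then have "x = (G ^^ Suc k) f + (G y + h)" using x by (simp add: G.add add.assoc)
  moreover have "G y + h \<in> filt (Suc k)" using f(2) h by (rule filt_SucI2)
  ultimately show ?case using f(1) by blast
qed

end

text \<open>Model: \<open>X\<close> is the derivative with respect to \<open>G\<close>, followed by
  \<open>C\<close>. It kills the coefficients \<open>N\<close>, its commutator with \<open>G\<close>
  is \<open>C\<close>, and \<open>C\<close> commutes with \<open>G\<close> up to lower
  degree.\<close>

locale op_lowering = op_filtered scale G N
  for scale :: "'k::field_char_0 \<Rightarrow> 'e::ab_group_add \<Rightarrow> 'e" (infixr "*s" 75) and G N +
  fixes X C :: "'e \<Rightarrow> 'e"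
  assumes linear_X: "Vector_Spaces.linear scale scale X"
    and linear_C: "Vector_Spaces.linear scale scale C"
    and X_N: "x \<in> N \<Longrightarrow> X x = 0"
    and X_G: "X (G x) = G (X x) + C x"
    and C_N: "x \<in> N \<Longrightarrow> C x \<in> N"
    and C_G: "x \<in> filt k \<Longrightarrow> C (G x) - G (C x) \<in> filt k"
begin

interpretation G: Vector_Spaces.linear scale scale G by (rule linear_G)
interpretation X: Vector_Spaces.linear scale scale X by (rule linear_X)
interpretation C: Vector_Spaces.linear scale scale C by (rule linear_C)

lemma C_funpow: "f \<in> N \<Longrightarrow> C ((G ^^ k) f) - (G ^^ k) (C f) \<in> filt k"
proof (induction k)
  case (Suc k)
  let ?y = "(G ^^ k) f"
  have "C (G ?y) - G (C ?y) \<in> filt (Suc k)" using C_G[OF funpow_G_filt] Suc.prems by blast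
  moreover have "G (C ?y - (G ^^ k) (C f)) \<in> filt (Suc k)" using filt_G Suc by blast
  ultimately have "C (G ?y) - G (C ?y) + G (C ?y - (G ^^ k) (C f)) \<in> filt (Suc k)"
    by (rule subspace_add[OF subspace_filt])
  then show ?case by (simp add: G.diff)
qed simp

text \<open>The product rule: each of the \<open>k + 1\<close> factors \<open>G\<close> contributes
  one \<open>C\<close>, and moving it past the other factors changes only terms of lower
  degree.\<close>

lemma X_funpow:
  "f \<in> N \<Longrightarrow> X ((G ^^ Suc k) f) - of_nat (Suc k) *s (G ^^ k) (C f) \<in> filt k"
proof (induction k)
  case 0
  then show ?case by (simp add: X_G X_N G.zero)
next
  case (Suc k)
  let ?y = "(G ^^ Suc k) f" and ?z = "(G ^^ k) (C f)"
  have 1: "G (X ?y - of_nat (Suc k) *s ?z) \<in> filt (Suc k)" using Suc filt_G by blast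
  have 2: "C ?y - G ?z \<in> filt (Suc k)" using C_funpow[OF Suc.prems, of "Suc k"] by simp
  have "X (G ?y) - of_nat (Suc (Suc k)) *s G ?z = G (X ?y - of_nat (Suc k) *s ?z) + (C ?y - G ?z)"
    by (simp only: X_G G.diff G.scale of_nat_Suc[of "Suc k"] scale_left_distrib scale_one) simp
  then show ?case using subspace_add[OF subspace_filt 1 2] by simp
qed

lemma X_filt: "x \<in> filt (Suc k) \<Longrightarrow> X x \<in> filt k"
proof (induction k arbitrary: x)
  case 0
  then show ?case by (auto simp: G.zero X_N)
next
  case (Suc k)
  from filt_leading[OF Suc.prems] obtain f y
    where f: "f \<in> N" "y \<in> filt (Suc k)" "x = (G ^^ Suc k) f + y" by blast
  have "of_nat (Suc k) *s (G ^^ k) (C f) \<in> filt (Suc k)"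
    by (intro subspace_scale[OF subspace_filt] funpow_G_filt C_N f)
  then have "X ((G ^^ Suc k) f) \<in> filt (Suc k)"
    using subspace_add[OF subspace_filt filt_SucI[OF X_funpow[OF f(1), of k]]] by fastforce
  moreover have "X y \<in> filt (Suc k)" using Suc.IH f(2) filt_SucI by blast
  ultimately show ?case using f(3) subspace_add[OF subspace_filt] by (simp only: X.add)
qed

text \<open>By \<open>X_filt\<close>, \<open>X\<close> is nilpotent on each level of the
  filtration.\<close>

lemma no_nonzero_eigenvector:
  assumes "c \<noteq> 0" "X x = c *s x" "x \<in> filt k"
  shows "x = 0"
  using assms(3)
proof (induction k)
  case (Suc k)
  then have "inverse c *s X x \<in> filt k" by (intro subspace_scale[OF subspace_filt] X_filt)
  then show ?case using Suc.IH assms(1,2) by simp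
qed simp

text \<open>Applying \<open>X\<close> to \<open>G\<^sup>d f + lower\<close> exactly \<open>d\<close> times leaves \<open>d! C\<^sup>d f\<close>.\<close>
lemma leading_coefficient_descends:
  assumes S: "subspace S" "\<And>x. x \<in> S \<Longrightarrow> X x \<in> S"
    and inj: "\<And>x. x \<in> N \<Longrightarrow> C x = 0 \<Longrightarrow> x = 0"
  shows "f \<in> N \<Longrightarrow> f \<noteq> 0 \<Longrightarrow> y \<in> filt k \<Longrightarrow> (G ^^ k) f + y \<in> S \<Longrightarrow> \<exists>h\<in>N. h \<in> S \<and> h \<noteq> 0"
proof (induction k arbitrary: f y)
  case 0
  then show ?case by auto
next
  case (Suc k)
  let ?f = "of_nat (Suc k) *s C f"
  let ?y = "X ((G ^^ Suc k) f) - of_nat (Suc k) *s (G ^^ k) (C f) + X y"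
  have lin: "(G ^^ k) (c *s z) = c *s (G ^^ k) z" for c z
    by (induction k) (simp_all add: G.scale)
  have "X ((G ^^ Suc k) f + y) = (G ^^ k) ?f + ?y"
    by (simp only: X.add lin) simp
  then have "(G ^^ k) ?f + ?y \<in> S" using S(2) Suc.prems(4) by metis
  moreover have "?y \<in> filt k"
    by (intro subspace_add[OF subspace_filt] X_funpow X_filt Suc.prems)
  moreover have "?f \<in> N" using subspace_scale[OF subspace_N C_N[OF Suc.prems(1)]] .
  moreover have "?f \<noteq> 0" using inj Suc.prems(1,2) by (auto simp del: of_nat_Suc)
  ultimately show ?case using Suc.IH by blast
qed

text \<open>Vanishing leading coefficients are dropped until a nonzero one appears, which
  \<open>leading_coefficient_descends\<close> then brings down to degree 0.\<close>

lemma meets_lower: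
  assumes S: "subspace S" "\<And>x. x \<in> S \<Longrightarrow> X x \<in> S"
    and inj: "\<And>x. x \<in> N \<Longrightarrow> C x = 0 \<Longrightarrow> x = 0"
    and x: "x \<in> S" "x \<noteq> 0" "x \<in> filt k"
  shows "\<exists>h\<in>N. h \<in> S \<and> h \<noteq> 0"
  using x(3)
proof (induction k)
  case 0
  then show ?case using x by simp
next
  case (Suc k)
  from filt_leading[OF this(2)] obtain f y
    where f: "f \<in> N" "y \<in> filt k" "x = (G ^^ k) f + y" by blast
  show ?case
  proof (cases "f = 0")
    case True
    have "(G ^^ k) 0 = 0" by (induction k) (simp_all add: G.zero)
    then show ?thesis using Suc.IH f True by simp
  next
    case False
    then show ?thesis using leading_coefficient_descends[OF S inj f(1) _ f(2)] f(3) x(1) by blast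
  qed
qed

end

section \<open>Modules over the Lie algebra and subspaces generated from a vector\<close>

lemma linear_imp_vector_space: "Vector_Spaces.linear s s f \<Longrightarrow> vector_space s"
  by (simp add: Vector_Spaces.linear_def)

text \<open>The operators at indices below -1 may be any linear maps: for valid \<open>a\<close> and
  \<open>b\<close> they enter the bracket with coefficient 0 only.\<close>

locale b_module = vector_space scale
  for scale :: "'k::field_char_0 \<Rightarrow> 'e::ab_group_add \<Rightarrow> 'e" (infixr "*s" 75) +
  fixes rho :: "gen \<Rightarrow> 'e \<Rightarrow> 'e"
  assumes linear_rho: "Vector_Spaces.linear scale scale (rho g)"
    and rho_comm: "validg a \<Longrightarrow> validg b \<Longrightarrow>
      rho a (rho b x) = rho b (rho a x) + lie_comb scale a b (\<lambda>g. rho g x)"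
begin

abbreviation "u k \<equiv> rho (U k)"
abbreviation "v k \<equiv> rho (V k)"

lemma rho_simps [simp]:
  "rho g (x + y) = rho g x + rho g y" "rho g (x - y) = rho g x - rho g y"
  "rho g (c *s x) = c *s rho g x" "rho g (- x) = - rho g x" "rho g 0 = 0"
proof -
  interpret r: Vector_Spaces.linear scale scale "rho g" by (rule linear_rho)
  show "rho g (x + y) = rho g x + rho g y" "rho g (x - y) = rho g x - rho g y"
    "rho g (c *s x) = c *s rho g x" "rho g (- x) = - rho g x" "rho g 0 = 0"
    by (simp_all add: r.add r.diff r.scale r.neg r.zero)
qed

lemma linearI:
  assumes "\<And>x y. f (x + y) = f x + f y" "\<And>c x. f (c *s x) = c *s f x"
  shows "Vector_Spaces.linear scale scale f"
  using assms by (simp add: Vector_Spaces.linear_def vector_space_axioms module_hom_iff module_axioms)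

lemma uv_comm: "-1 \<le> i \<Longrightarrow> -1 \<le> j \<Longrightarrow> u i (v j x) = v j (u i x) +
   (of_int (i - j + 1) *s v (i + j + 2) x - (4 * of_int (i - j)) *s v (i + j) x)"
  by (subst rho_comm) (simp_all add: validg_def)

lemma vu_comm: "-1 \<le> i \<Longrightarrow> -1 \<le> j \<Longrightarrow> v j (u i x) = u i (v j x) -
   (of_int (i - j + 1) *s v (i + j + 2) x - (4 * of_int (i - j)) *s v (i + j) x)"
  by (simp add: uv_comm)

lemma vv_comm: "-1 \<le> i \<Longrightarrow> -1 \<le> j \<Longrightarrow> v i (v j x) = v j (v i x)"
  by (subst rho_comm) (simp_all add: validg_def)

lemma uu_comm: "-1 \<le> i \<Longrightarrow> -1 \<le> j \<Longrightarrow> u i (u j x) = u j (u i x) +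
   of_int (i - j) *s (u (i + j + 2) x - 4 *s u (i + j) x)"
  by (subst rho_comm) (simp_all add: validg_def)

inductive_set generated :: "gen set \<Rightarrow> 'e \<Rightarrow> 'e set" for H w where
  gen_base: "w \<in> generated H w"
| gen_add: "x \<in> generated H w \<Longrightarrow> y \<in> generated H w \<Longrightarrow> x + y \<in> generated H w"
| gen_scale: "x \<in> generated H w \<Longrightarrow> c *s x \<in> generated H w"
| gen_act: "x \<in> generated H w \<Longrightarrow> g \<in> H \<Longrightarrow> rho g x \<in> generated H w"

lemma subspace_generated: "subspace (generated H w)"
proof -
  have "0 *s w \<in> generated H w" by (intro gen_scale gen_base)
  then show ?thesis by (simp add: subspace_def gen_add gen_scale)
qed

lemma generated_mono: "x \<in> generated H w \<Longrightarrow> H \<subseteq> H' \<Longrightarrow> x \<in> generated H' w"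
  by (induction rule: generated.induct) (auto intro: generated.intros)

text \<open>Commutators of \<open>g\<close> with \<open>H\<close> stay in the span of
  \<open>g\<close> and \<open>H\<close>, so each \<open>g\<close> in a word can be moved to the left
  at the cost of terms of no higher degree in \<open>g\<close>.\<close>

lemma generated_filtration:
  assumes comm: "\<And>y x. y \<in> H \<Longrightarrow> rho y (rho g x) - rho g (rho y x) \<in> span ((\<lambda>h. rho h x) ` insert g H)"
  shows "y \<in> H \<Longrightarrow> x \<in> op_filtration (rho g) (generated H w) k \<Longrightarrow>
      rho y x \<in> op_filtration (rho g) (generated H w) k"
    and "x \<in> generated (insert g H) w \<Longrightarrow> \<exists>k. x \<in> op_filtration (rho g) (generated H w) k"
proof -
  interpret op_filtered scale "rho g" "generated H w"
    by unfold_locales (simp_all add: linear_rho linear_imp_vector_space subspace_generated)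
  have "\<forall>y\<in>H. \<forall>x\<in>filt k. rho y x \<in> filt k" for k
  proof (induction k)
    case (Suc k)
    show ?case
    proof (intro ballI)
      fix y x assume y: "y \<in> H" and "x \<in> filt (Suc k)"
      then obtain a b where ab: "a \<in> filt k" "b \<in> generated H w" "x = rho g a + b" by auto
      let ?e = "rho y (rho g a) - rho g (rho y a)"
      have "span ((\<lambda>h. rho h a) ` insert g H) \<subseteq> filt (Suc k)"
      proof (intro span_minimal subspace_filt)
        show "(\<lambda>h. rho h a) ` insert g H \<subseteq> filt (Suc k)"
          using Suc ab(1) filt_G[OF ab(1)] filt_SucI by blast
      qed
      then have "?e \<in> filt (Suc k)" using comm[OF y] by blast
      moreover have "rho g (rho y a) \<in> filt (Suc k)" using filt_G Suc ab(1) y by blast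
      moreover have "rho y b \<in> filt (Suc k)" using N_filt generated.gen_act[OF ab(2) y] by blast
      ultimately have "?e + rho g (rho y a) + rho y b \<in> filt (Suc k)"
        using subspace_add[OF subspace_filt] by blast
      then show "rho y x \<in> filt (Suc k)" using ab(3) by simp
    qed
  qed simp
  then show stable: "rho y x \<in> filt k" if "y \<in> H" "x \<in> filt k" for y x k
    using that by blast
  show "\<exists>k. x \<in> filt k" if "x \<in> generated (insert g H) w"
    using that
  proof (induction rule: generated.induct)
    case gen_base
    show ?case using N_filt[OF generated.gen_base] by blast
  next
    case (gen_add x y)
    then obtain k l where kl: "x \<in> filt k" "y \<in> filt l" by blast
    have mono: "filt i \<subseteq> filt (i + j)" for i j
      by (induction j) (use filt_SucI in auto)
    from kl mono[of k l] mono[of l k] have "x \<in> filt (k + l)" "y \<in> filt (k + l)"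
      by (auto simp: add.commute)
    then show ?case using subspace_add[OF subspace_filt] by blast
  next
    case (gen_scale x c)
    then show ?case using subspace_scale[OF subspace_filt] by blast
  next
    case (gen_act x h)
    then obtain k where k: "x \<in> filt k" by blast
    show ?case
    proof (cases "h = g")
      case True
      then show ?thesis using filt_G[OF k] by blast
    next
      case False
      then show ?thesis using stable[OF _ k] gen_act(2) by blast
    qed
  qed
qed

end

section \<open>Descent to a vector on which \<open>F_n\<close> acts by a character\<close>

locale whittaker_module = b_module scale rho
  for scale :: "'k::field_char_0 \<Rightarrow> 'e::ab_group_add \<Rightarrow> 'e" (infixr "*s" 75) and rho +
  fixes \<psi> :: "gen \<Rightarrow> 'k" and w :: 'e and n m :: int
  assumes n: "0 \<le> n"
    and eigen: "n \<le> gidx g \<Longrightarrow> rho g w = \<psi> g *s w"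
    and hom: "n \<le> gidx a \<Longrightarrow> n \<le> gidx b \<Longrightarrow> lie_comb (*) a b \<psi> = 0"
    and m: "n \<le> m" "2 * n - 1 \<le> m" "\<psi> (V m) \<noteq> 0" "\<And>k. m < k \<Longrightarrow> \<psi> (V k) = 0"
begin

text \<open>The sets of a descending chain: \<open>U_from (-1)\<close> is all valid generators, each
  step drops one, \<open>U_from n = V_from (-1)\<close>, and \<open>V_from n\<close> is the basis of
  \<open>F_n\<close>, which generates only the multiples of \<open>w\<close>.\<close>

definition "U_from i = {U l | l. i \<le> l} \<union> {V l | l. -1 \<le> l}"
definition "V_from i = {U l | l. n \<le> l} \<union> {V l | l. i \<le> l}"
abbreviation "M_U i \<equiv> generated (U_from i) w"
abbreviation "M_V i \<equiv> generated (V_from i) w"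

text \<open>For \<open>l, r \<ge> n\<close> the bracket of \<open>U r\<close> and \<open>V l\<close>
  lies in \<open>F_n\<close> and is killed by \<open>\<psi>\<close>; every \<open>V r\<close>
  commutes with \<open>V l\<close>.\<close>

lemma v_eigen_M_V: "x \<in> M_V (-1) \<Longrightarrow> n \<le> l \<Longrightarrow> v l x = \<psi> (V l) *s x"
proof (induction arbitrary: l rule: generated.induct)
  case gen_base
  then show ?case by (simp add: eigen)
next
  case (gen_act x g)
  from gen_act(2) consider r where "g = U r" "n \<le> r" | r where "g = V r" "-1 \<le> r"
    by (auto simp: V_from_def)
  then show ?case
  proof cases
    case (1 r)
    have r: "n \<le> r + l" "n \<le> r + l + 2" "-1 \<le> r" "-1 \<le> l" using 1 gen_act(4) n by auto
    have "(of_int (r - l + 1) * \<psi> (V (r + l + 2)) - 4 * of_int (r - l) * \<psi> (V (r + l))) *s x = 0"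
      using hom[of "U r" "V l"] 1 gen_act(4) by simp
    then have "of_int (r - l + 1) *s \<psi> (V (r + l + 2)) *s x - (4 * of_int (r - l)) *s \<psi> (V (r + l)) *s x = 0"
      by (simp only: scale_left_diff_distrib scale_scale)
    then show ?thesis using 1 r gen_act.IH gen_act(4) by (auto simp: vu_comm)
  next
    case (2 r)
    then show ?thesis using gen_act.IH gen_act(4) n by (simp add: vv_comm[of l r])
  qed
qed (simp_all add: scale_right_distrib scale_left_commute)

text \<open>For \<open>l \<ge> m - i\<close> and \<open>r > i\<close> the bracket of
  \<open>U l\<close> with \<open>V r\<close> has indices above \<open>m\<close>, where the
  \<open>V\<close> act as zero. Brackets with \<open>U r\<close>, \<open>r \<ge> n\<close>, stay in
  \<open>F_n\<close> because \<open>m - i \<ge> n\<close>, and \<open>\<psi>\<close> kills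
  them.\<close>

lemma u_eigen_M_V:
  assumes "-1 \<le> i" "i < n"
  shows "x \<in> M_V (i + 1) \<Longrightarrow> m - i \<le> l \<Longrightarrow> u l x = \<psi> (U l) *s x"
proof (induction arbitrary: l rule: generated.induct)
  case gen_base
  then show ?case using assms m by (simp add: eigen)
next
  case (gen_act x g)
  have x: "x \<in> M_V (-1)"
    using gen_act(1) assms by (rule_tac generated_mono) (auto simp: V_from_def)
  from gen_act(2) consider r where "g = U r" "n \<le> r" | r where "g = V r" "i + 1 \<le> r"
    by (auto simp: V_from_def)
  then show ?case
  proof cases
    case (1 r)
    have r: "m - i \<le> l + r" "m - i \<le> l + r + 2" "-1 \<le> r" "-1 \<le> l" "n \<le> l" using 1 gen_act(4) n m assms by auto
    have "(of_int (l - r) * (\<psi> (U (l + r + 2)) - 4 * \<psi> (U (l + r)))) *s x = 0"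
      using hom[of "U l" "U r"] 1 r by simp
    then have "of_int (l - r) *s (\<psi> (U (l + r + 2)) *s x - 4 *s \<psi> (U (l + r)) *s x) = 0"
      by (simp only: scale_left_diff_distrib scale_scale scale_right_diff_distrib right_diff_distrib)
    then show ?thesis using 1 r gen_act.IH gen_act(4) by (simp add: uu_comm[of l r])
  next
    case (2 r)
    have r: "m < l + r" "n \<le> l + r" "-1 \<le> r" "-1 \<le> l" using 2 gen_act(4) n m assms by auto
    then have "v (l + r) x = 0" "v (l + r + 2) x = 0" by (simp_all add: v_eigen_M_V[OF x] m)
    then show ?thesis using 2 r gen_act.IH gen_act(4) by (simp add: uv_comm)
  qed
qed (simp_all add: scale_right_distrib scale_left_commute)

text \<open>Moving \<open>V l\<close> past \<open>U r\<close> with \<open>r > i\<close> produces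
  only \<open>V\<close> of index above \<open>m\<close>. As \<open>r \<ge> 0\<close>, these indices
  are also at least \<open>m - i\<close>, so the induction hypothesis shows that they act as
  zero.\<close>

lemma v_eigen_M_U:
  assumes "-1 \<le> i" "n \<le> m - i"
  shows "x \<in> M_U (i + 1) \<Longrightarrow> m - i \<le> l \<Longrightarrow> v l x = \<psi> (V l) *s x"
proof (induction arbitrary: l rule: generated.induct)
  case gen_base
  then show ?case using assms m by (simp add: eigen)
next
  case (gen_act x g)
  from gen_act(2) consider r where "g = U r" "i + 1 \<le> r" | r where "g = V r" "-1 \<le> r"
    by (auto simp: U_from_def)
  then show ?case
  proof cases
    case (1 r)
    have r: "m < r + l" "m - i \<le> r + l" "m - i \<le> r + l + 2" "-1 \<le> r" "-1 \<le> l" using 1 gen_act(4) n m assms by auto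
    then have "\<psi> (V (r + l)) = 0" "\<psi> (V (r + l + 2)) = 0" by (simp_all add: m)
    then show ?thesis using 1 r gen_act.IH gen_act(4) by (simp add: vu_comm)
  next
    case (2 r)
    then show ?thesis using gen_act.IH gen_act(4) n assms by (simp add: vv_comm[of l r])
  qed
qed (simp_all add: scale_right_distrib scale_left_commute)

text \<open>Since \<open>r \<ge> n \<ge> 0\<close>, the bracket of \<open>U r\<close> with
  \<open>V i\<close> involves only indices at least \<open>i\<close>.\<close>

lemma filtration_V:
  assumes "-1 \<le> i" "i < n"
  shows "x \<in> M_V i \<Longrightarrow> \<exists>k. x \<in> op_filtration (v i) (M_V (i + 1)) k"
proof -
  have eq: "V_from i = insert (V i) (V_from (i + 1))" by (auto simp: V_from_def)
  have "rho y (v i x) - v i (rho y x) \<in> span ((\<lambda>h. rho h x) ` insert (V i) (V_from (i + 1)))"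
    if "y \<in> V_from (i + 1)" for y x
  proof -
    let ?W = "span ((\<lambda>h. rho h x) ` V_from i)"
    have "rho y (v i x) - v i (rho y x) = lie_comb scale y (V i) (\<lambda>g. rho g x)"
      using that n assms by (subst rho_comm) (auto simp: validg_def V_from_def)
    moreover from that consider r where "y = U r" "n \<le> r" | r where "y = V r" "i + 1 \<le> r"
      by (auto simp: V_from_def)
    then have "lie_comb scale y (V i) (\<lambda>g. rho g x) \<in> ?W"
    proof cases
      case (1 r)
      then have "V (r + i + 2) \<in> V_from i" "V (r + i) \<in> V_from i" using n by (auto simp: V_from_def)
      then show ?thesis unfolding 1(1)
        by (intro lie_comb_in_subspace) (auto intro: span_base)
    next
      case (2 r)
      then show ?thesis by (simp add: span_zero)
    qed
    ultimately show ?thesis by (simp add: eq)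
  qed
  from generated_filtration(2)[OF this] eq show "x \<in> M_V i \<Longrightarrow> \<exists>k. x \<in> op_filtration (v i) (M_V (i + 1)) k"
    by simp
qed

text \<open>An index \<open>r > i \<ge> -1\<close> is nonnegative, so the bracket of
  \<open>U r\<close> with \<open>U i\<close> has indices at least \<open>i\<close>; brackets with
  the \<open>V\<close> remain among the \<open>V\<close>. The second part is what makes
  \<open>C\<close> commute with \<open>U i\<close> up to lower degree in
  \<open>lowering_U\<close>.\<close>

lemma filtration_U:
  assumes "-1 \<le> i"
  shows "x \<in> M_U i \<Longrightarrow> \<exists>k. x \<in> op_filtration (u i) (M_U (i + 1)) k"
    and "-1 \<le> l \<Longrightarrow> x \<in> op_filtration (u i) (M_U (i + 1)) k \<Longrightarrow> v l x \<in> op_filtration (u i) (M_U (i + 1)) k"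
proof -
  have eq: "U_from i = insert (U i) (U_from (i + 1))" by (auto simp: U_from_def)
  have *: "rho y (u i x) - u i (rho y x) \<in> span ((\<lambda>h. rho h x) ` insert (U i) (U_from (i + 1)))"
    if "y \<in> U_from (i + 1)" for y x
  proof -
    let ?W = "span ((\<lambda>h. rho h x) ` U_from i)"
    have "rho y (u i x) - u i (rho y x) = lie_comb scale y (U i) (\<lambda>g. rho g x)"
      using that n assms by (subst rho_comm) (auto simp: validg_def U_from_def)
    moreover from that consider r where "y = U r" "i + 1 \<le> r" | r where "y = V r" "-1 \<le> r"
      by (auto simp: U_from_def)
    then have "lie_comb scale y (U i) (\<lambda>g. rho g x) \<in> ?W"
    proof cases
      case (1 r)
      then have "U (r + i + 2) \<in> U_from i" "U (r + i) \<in> U_from i" using assms by (auto simp: U_from_def)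
      then show ?thesis using 1 unfolding 1(1)
        by (intro lie_comb_in_subspace) (auto intro: span_base)
    next
      case (2 r)
      then have "V (i + r + 2) \<in> U_from i" "i \<noteq> r \<Longrightarrow> V (i + r) \<in> U_from i"
        using assms by (auto simp: U_from_def)
      then show ?thesis using 2 unfolding 2(1)
        by (intro lie_comb_in_subspace) (auto intro: span_base)
    qed
    ultimately show ?thesis by (simp add: eq)
  qed
  from generated_filtration(2)[OF *] eq show "x \<in> M_U i \<Longrightarrow> \<exists>k. x \<in> op_filtration (u i) (M_U (i + 1)) k"
    by simp
  show "x \<in> op_filtration (u i) (M_U (i + 1)) k \<Longrightarrow> v l x \<in> op_filtration (u i) (M_U (i + 1)) k"
    if "-1 \<le> l" using generated_filtration(1)[OF *] that by (auto simp: U_from_def)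
qed

text \<open>The index \<open>m - i\<close> is chosen so that its bracket \<open>C\<close> with
  \<open>V i\<close> involves \<open>V m\<close> and \<open>V (m + 2)\<close>. Both commute with
  \<open>V i\<close>, so \<open>C\<close> does so exactly.\<close>

lemma lowering_V:
  assumes "-1 \<le> i" "i < n"
  shows "op_lowering scale (v i) (M_V (i + 1)) (\<lambda>x. u (m - i) x - \<psi> (U (m - i)) *s x)
    (\<lambda>x. of_int (m - i - i + 1) *s v (m + 2) x - (4 * of_int (m - i - i)) *s v m x)"
proof -
  have i: "-1 \<le> m - i" using assms m n by auto
  have mem: "v m x \<in> M_V (i + 1)" "v (m + 2) x \<in> M_V (i + 1)" if "x \<in> M_V (i + 1)" for x
    using that assms m by (auto intro!: generated.gen_act simp: V_from_def)
  show ?thesis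
  proof unfold_locales
    show "subspace (M_V (i + 1))" by (rule subspace_generated)
    show "u (m - i) x - \<psi> (U (m - i)) *s x = 0" if "x \<in> M_V (i + 1)" for x
      using u_eigen_M_V[OF assms that] by simp
    show "of_int (m - i - i + 1) *s v (m + 2) x - (4 * of_int (m - i - i)) *s v m x \<in> M_V (i + 1)"
      if "x \<in> M_V (i + 1)" for x
      by (intro subspace_diff subspace_scale subspace_generated mem that)
    fix x
    show "u (m - i) (v i x) - \<psi> (U (m - i)) *s v i x = v i (u (m - i) x - \<psi> (U (m - i)) *s x) +
      (of_int (m - i - i + 1) *s v (m + 2) x - (4 * of_int (m - i - i)) *s v m x)"
      using uv_comm[OF i assms(1), of x] by (simp add: algebra_simps)
    have "v i (v m x) = v m (v i x)" "v i (v (m + 2) x) = v (m + 2) (v i x)"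
      using assms m n by (auto intro!: vv_comm)
    then show "of_int (m - i - i + 1) *s v (m + 2) (v i x) - (4 * of_int (m - i - i)) *s v m (v i x) -
      v i (of_int (m - i - i + 1) *s v (m + 2) x - (4 * of_int (m - i - i)) *s v m x)
        \<in> op_filtration (v i) (M_V (i + 1)) k" for k
      using op_filtered.subspace_filt[of scale "v i" "M_V (i + 1)" k, THEN subspace_0]
      by (simp add: op_filtered_def op_filtered_axioms_def linear_rho subspace_generated vector_space_axioms)
  qed (simp_all add: linear_rho linearI scale_right_distrib scale_right_diff_distrib scale_left_commute algebra_simps)
qed

text \<open>\<open>C\<close> is minus the bracket of \<open>U i\<close> with
  \<open>V (m - i)\<close>. It commutes with \<open>U i\<close> only up to further \<open>V\<close>,
  which do not raise the degree in \<open>U i\<close>.\<close>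

lemma lowering_U:
  assumes "-1 \<le> i" "n \<le> m - i"
  shows "op_lowering scale (u i) (M_U (i + 1)) (\<lambda>x. v (m - i) x - \<psi> (V (m - i)) *s x)
    (\<lambda>x. - (of_int (i - (m - i) + 1) *s v (m + 2) x - (4 * of_int (i - (m - i))) *s v m x))"
proof -
  have i: "-1 \<le> m - i" using assms m n by auto
  have mem: "v m x \<in> M_U (i + 1)" "v (m + 2) x \<in> M_U (i + 1)" if "x \<in> M_U (i + 1)" for x
    using that assms m n by (auto intro!: generated.gen_act simp: U_from_def)
  interpret op_filtered scale "u i" "M_U (i + 1)"
    by unfold_locales (simp_all add: linear_rho subspace_generated)
  show ?thesis
  proof unfold_locales
    show "v (m - i) x - \<psi> (V (m - i)) *s x = 0" if "x \<in> M_U (i + 1)" for x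
      using v_eigen_M_U[OF assms that] by simp
    show "- (of_int (i - (m - i) + 1) *s v (m + 2) x - (4 * of_int (i - (m - i))) *s v m x) \<in> M_U (i + 1)"
      if "x \<in> M_U (i + 1)" for x
      by (intro subspace_neg subspace_diff subspace_scale subspace_generated mem that)
    fix x
    show "v (m - i) (u i x) - \<psi> (V (m - i)) *s u i x = u i (v (m - i) x - \<psi> (V (m - i)) *s x) +
      - (of_int (i - (m - i) + 1) *s v (m + 2) x - (4 * of_int (i - (m - i))) *s v m x)"
      using vu_comm[OF assms(1) i, of x] by (simp add: algebra_simps)
    fix k assume x: "x \<in> filt k"
    have comm: "v l (u i x) - u i (v l x) \<in> filt k" if "0 \<le> l" for l
    proof -
      have "of_int (i - l + 1) *s v (i + l + 2) x - (4 * of_int (i - l)) *s v (i + l) x \<in> filt k"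
        using filtration_U(2)[OF assms(1) _ x] assms(1) that
        by (intro subspace_diff subspace_scale subspace_filt) auto
      from subspace_neg[OF subspace_filt this] show ?thesis using vu_comm[of i l x] assms that by simp
    qed
    have "- (of_int (i - (m - i) + 1) *s (v (m + 2) (u i x) - u i (v (m + 2) x)) -
       (4 * of_int (i - (m - i))) *s (v m (u i x) - u i (v m x))) \<in> filt k"
      using n m by (intro subspace_neg subspace_diff subspace_scale subspace_filt comm) auto
    then show "- (of_int (i - (m - i) + 1) *s v (m + 2) (u i x) - (4 * of_int (i - (m - i))) *s v m (u i x)) -
      u i (- (of_int (i - (m - i) + 1) *s v (m + 2) x - (4 * of_int (i - (m - i))) *s v m x)) \<in> filt k"
      by (simp add: algebra_simps)
  qed (simp_all add: linear_rho linearI scale_right_distrib scale_right_diff_distrib scale_left_commute algebra_simps)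
qed

text \<open>On the part generated by \<open>U\<^sub>0\<close> and higher, \<open>V\<^sub>m\<close> is not a scalar, but a nonzero
  scalar plus an operator that lowers the degree in \<open>U\<^sub>0\<close>.\<close>
lemma v_m_inj:
  assumes x: "x \<in> M_U 0" "v m x = 0"
  shows "x = 0"
proof -
  interpret op_lowering scale "u 0" "M_U (0 + 1)" "\<lambda>x. v (m - 0) x - \<psi> (V (m - 0)) *s x"
    "\<lambda>x. - (of_int (0 - (m - 0) + 1) *s v (m + 2) x - (4 * of_int (0 - (m - 0))) *s v m x)"
    using m by (intro lowering_U) auto
  obtain k where "x \<in> filt k" using filtration_U(1)[of 0 x] x by auto
  \<comment> \<open>\<open>v m x = 0\<close> says that \<open>X\<close> maps \<open>x\<close> to
    \<open>- \<psi> (V m)\<close> times \<open>x\<close>.\<close>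
  then show ?thesis
    using no_nonzero_eigenvector[of "- \<psi> (V m)" x k] m(3) x(2) by simp
qed

text \<open>Walk down the chain: a nonzero vector of \<open>S\<close> in one space yields one in the
  next by \<open>meets_lower\<close>, and the last space consists of multiples of
  \<open>w\<close>.\<close>

lemma submodule_contains_cyclic_vector:
  assumes S: "subspace S" "\<And>g x. validg g \<Longrightarrow> x \<in> S \<Longrightarrow> rho g x \<in> S"
    and x: "x \<in> S" "x \<noteq> 0" "x \<in> M_U (-1)"
  shows "w \<in> S"
proof -
  have step_U: "\<exists>h\<in>M_U (i + 1). h \<in> S \<and> h \<noteq> 0" if i: "-1 \<le> i" "i < n" and x: "x \<in> M_U i" "x \<in> S" "x \<noteq> 0" for i x
  proof -
    \<comment> \<open>From \<open>i \<le> n - 1\<close> and \<open>m \<ge> 2 n - 1\<close>: the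
      operator \<open>V (m - i)\<close> lies in \<open>F_n\<close>, and the factor
      \<open>2 i - m\<close> of \<open>V m\<close> in \<open>C\<close> is nonzero.\<close>
    have i': "n \<le> m - i" "2 * i - m < 0" using i m by auto
    interpret op_lowering scale "u i" "M_U (i + 1)" "\<lambda>x. v (m - i) x - \<psi> (V (m - i)) *s x"
      "\<lambda>x. - (of_int (i - (m - i) + 1) *s v (m + 2) x - (4 * of_int (i - (m - i))) *s v m x)"
      using i(1) i'(1) by (rule lowering_U)
    obtain k where k: "x \<in> filt k" using filtration_U(1)[OF i(1) x(1)] by blast
    have inj: "y = 0" if y: "y \<in> M_U (i + 1)"
      "- (of_int (i - (m - i) + 1) *s v (m + 2) y - (4 * of_int (i - (m - i))) *s v m y) = 0" for y
    proof -
      \<comment> \<open>\<open>\<psi>\<close> vanishes at \<open>V (m + 2)\<close>, so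
        \<open>C\<close> reduces to a nonzero multiple of \<open>V m\<close>.\<close>
      have "v (m + 2) y = 0" using v_eigen_M_U[OF i(1) i'(1) y(1), of "m + 2"] i m by simp
      then have "(4 * of_int (i - (m - i))) *s v m y = 0" using y(2) by simp
      moreover have "(4 * of_int (i - (m - i)) :: 'k) \<noteq> 0" using i'(2) by (simp del: of_int_diff)
      ultimately have z: "v m y = 0" by (simp del: of_int_diff)
      show ?thesis
      \<comment> \<open>\<open>V m\<close> is known to act as a scalar on \<open>M_U (i + 1)\<close>
        only if \<open>m \<ge> m - i\<close>, that is \<open>i \<ge> 0\<close>;
        \<open>i = -1\<close> is the case for which \<open>v_m_inj\<close> was made.\<close>
      proof (cases "i = -1")
        case True
        then show ?thesis using v_m_inj[of y] y(1) z by simp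
      next
        case False
        then show ?thesis using v_eigen_M_U[OF i(1) i'(1) y(1), of m] z m(3) i by simp
      qed
    qed
    show ?thesis
      by (rule meets_lower[OF S(1) _ inj x(2,3) k])
        (use i i' n in \<open>auto intro!: subspace_diff[OF S(1)] subspace_scale[OF S(1)] S(2) simp: validg_def\<close>)
  qed
  have step_V: "\<exists>h\<in>M_V (i + 1). h \<in> S \<and> h \<noteq> 0" if i: "-1 \<le> i" "i < n" and x: "x \<in> M_V i" "x \<in> S" "x \<noteq> 0" for i x
  proof -
    \<comment> \<open>The same bounds make the factor \<open>m - 2 i\<close> of \<open>V m\<close>
      in \<open>C\<close> positive; \<open>V m\<close> acts as the nonzero scalar
      \<open>\<psi> (V m)\<close> on all of \<open>M_V (-1)\<close>.\<close>
    have i': "n \<le> m - i" "m - i - i > 0" using i m by auto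
    interpret op_lowering scale "v i" "M_V (i + 1)" "\<lambda>x. u (m - i) x - \<psi> (U (m - i)) *s x"
      "\<lambda>x. of_int (m - i - i + 1) *s v (m + 2) x - (4 * of_int (m - i - i)) *s v m x"
      using i by (rule lowering_V)
    obtain k where k: "x \<in> filt k" using filtration_V[OF i x(1)] by blast
    have inj: "y = 0" if y: "y \<in> M_V (i + 1)"
      "of_int (m - i - i + 1) *s v (m + 2) y - (4 * of_int (m - i - i)) *s v m y = 0" for y
    proof -
      have y': "y \<in> M_V (-1)" using y(1) i by (rule_tac generated_mono) (auto simp: V_from_def)
      then have "v (m + 2) y = 0" using m by (simp add: v_eigen_M_V)
      then have "(4 * of_int (m - i - i)) *s v m y = 0" using y(2) by simp
      moreover have "(4 * of_int (m - i - i) :: 'k) \<noteq> 0" using i'(2) by (simp del: of_int_diff)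
      ultimately have z: "v m y = 0" by (simp del: of_int_diff)
      then show ?thesis using v_eigen_M_V[OF y', of m] m by simp
    qed
    show ?thesis
      by (rule meets_lower[OF S(1) _ inj x(2,3) k])
        (use i i' n in \<open>auto intro!: subspace_diff[OF S(1)] subspace_scale[OF S(1)] S(2) simp: validg_def\<close>)
  qed
  have "-1 \<le> i \<Longrightarrow> i \<le> n \<Longrightarrow> \<exists>h\<in>M_U i. h \<in> S \<and> h \<noteq> 0" for i
    by (induction i rule: int_ge_induct) (use x step_U in auto)
  then have "\<exists>h\<in>M_U n. h \<in> S \<and> h \<noteq> 0" using n by simp
  \<comment> \<open>Here the two halves of the chain meet.\<close>
  moreover have "U_from n = V_from (-1)" by (auto simp: U_from_def V_from_def)
  ultimately have base: "\<exists>h\<in>M_V (-1). h \<in> S \<and> h \<noteq> 0" by simp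
  have "-1 \<le> i \<Longrightarrow> i \<le> n \<Longrightarrow> \<exists>h\<in>M_V i. h \<in> S \<and> h \<noteq> 0" for i
    by (induction i rule: int_ge_induct) (use base step_V in auto)
  from this[of n] obtain h where h: "h \<in> M_V n" "h \<in> S" "h \<noteq> 0" using n by auto
  from h(1) have "\<exists>c. h = c *s w"
  proof (induction rule: generated.induct)
    case gen_base
    show ?case by (rule exI[of _ 1]) simp
  next
    case (gen_add x y)
    then show ?case by (metis scale_left_distrib)
  next
    case (gen_scale x c)
    then show ?case by (metis scale_scale)
  next
    case (gen_act x g)
    then have "n \<le> gidx g" by (auto simp: V_from_def)
    with gen_act show ?case by (auto simp: eigen)
  qed
  then obtain c where c: "h = c *s w" by blast
  with h(3) have "w = inverse c *s h" by auto
  then show ?thesis using subspace_scale[OF S(1) h(2)] by simp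
qed

end

section \<open>Left ideals of the tensor algebra\<close>

lemma tadd_eq: "tadd f g = f + g" and tsub_eq: "tsub f g = f - g"
  by (auto simp: tadd_def tsub_def)

interpretation tens_space: vector_space "tsmul :: 'k::field \<Rightarrow> (gen list \<Rightarrow> 'k) \<Rightarrow> gen list \<Rightarrow> 'k"
  by unfold_locales (auto simp: tsmul_def algebra_simps)

text \<open>The closed form of \<open>tmul (mono [a])\<close>, convenient because it is visibly
  linear and shifts supports.\<close>

definition lmul :: "gen \<Rightarrow> (gen list \<Rightarrow> 'k::field) \<Rightarrow> gen list \<Rightarrow> 'k" where
  "lmul a f w = (case w of [] \<Rightarrow> 0 | x # xs \<Rightarrow> if x = a then f xs else 0)"

lemma lmul_simps [simp]:
  "lmul a f [] = 0" "lmul a f (x # xs) = (if x = a then f xs else 0)"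
  by (simp_all add: lmul_def)

lemma linear_lmul: "Vector_Spaces.linear tsmul tsmul (lmul a)"
  by unfold_locales (auto simp: tsmul_def lmul_def fun_eq_iff algebra_simps split: list.split)

interpretation lmul: Vector_Spaces.linear tsmul tsmul "lmul a"
  by (rule linear_lmul)

lemma tmul_add: "tmul (p + q) f = tmul p f + tmul q f" and tmul_smul: "tmul (tsmul c p) f = tsmul c (tmul p f)"
  and tmul_diff: "tmul (p - q) f = tmul p f - tmul q f"
  by (auto simp: tmul_def tsmul_def fun_eq_iff algebra_simps sum.distrib sum_subtractf sum_distrib_left)

lemma tmul_zero [simp]: "tmul 0 f = 0"
  by (auto simp: tmul_def)

lemma tmul_lmul: "tmul (lmul a p) f = lmul a (tmul p f)"
proof
  fix w
  show "tmul (lmul a p) f w = lmul a (tmul p f) w"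
    by (cases w) (simp_all add: tmul_def sum.atMost_Suc_shift del: sum.atMost_Suc)
qed

lemma tmul_mono_Nil: "tmul (mono []) f = f"
proof
  fix w
  have "tmul (mono []) f w = (\<Sum>i\<le>length w. if i = 0 then f w else 0)"
    unfolding tmul_def mono_def by (intro sum.cong) auto
  then show "tmul (mono []) f w = f w" by simp
qed

lemma mono_Cons: "mono (a # w) = lmul a (mono w)"
  by (auto simp: mono_def fun_eq_iff lmul_def split: list.split)

lemma tmul_mono_Cons: "tmul (mono (a # w)) f = lmul a (tmul (mono w) f)"
  by (simp add: mono_Cons tmul_lmul)

lemma tmul_mono_single: "tmul (mono [a]) f = lmul a f"
  by (simp add: tmul_mono_Cons tmul_mono_Nil)

lemma tmul_mono_pair: "tmul (mono [a, b]) f = lmul a (lmul b f)"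
  by (simp add: tmul_mono_Cons tmul_mono_Nil)

lemma lmul_mono: "lmul a (mono w) = mono (a # w)"
  by (simp add: mono_Cons)

abbreviation valid_word :: "gen list \<Rightarrow> bool" where
  "valid_word w \<equiv> \<forall>g\<in>set w. validg g"

lemma tensI: "finite {w. f w \<noteq> 0} \<Longrightarrow> (\<And>w. f w \<noteq> 0 \<Longrightarrow> valid_word w) \<Longrightarrow> f \<in> tens"
  by (simp add: tens_def)

lemma tensD: "f \<in> tens \<Longrightarrow> finite {w. f w \<noteq> 0}" "f \<in> tens \<Longrightarrow> f w \<noteq> 0 \<Longrightarrow> valid_word w"
  by (simp_all add: tens_def)

lemma subspace_tens: "tens_space.subspace tens"
  unfolding tens_space.subspace_def
proof (intro conjI ballI allI)
  show "0 \<in> tens" by (rule tensI) simp_all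
next
  fix f g :: "gen list \<Rightarrow> 'a" assume fg: "f \<in> tens" "g \<in> tens"
  show "f + g \<in> tens"
  proof (rule tensI)
    have "{w. (f + g) w \<noteq> 0} \<subseteq> {w. f w \<noteq> 0} \<union> {w. g w \<noteq> 0}" by auto
    then show "finite {w. (f + g) w \<noteq> 0}" by (rule finite_subset) (simp add: tensD(1) fg)
    show "valid_word w" if "(f + g) w \<noteq> 0" for w
      using that fg[THEN tensD(2), of w] by (cases "f w = 0") simp_all
  qed
next
  fix c and f :: "gen list \<Rightarrow> 'a" assume f: "f \<in> tens"
  show "tsmul c f \<in> tens"
  proof (rule tensI)
    have "{w. tsmul c f w \<noteq> 0} \<subseteq> {w. f w \<noteq> 0}" by (auto simp: tsmul_def)
    then show "finite {w. tsmul c f w \<noteq> 0}" by (rule finite_subset) (simp add: tensD(1) f)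
    show "valid_word w" if "tsmul c f w \<noteq> 0" for w
      using that tensD(2)[OF f, of w] by (simp add: tsmul_def)
  qed
qed

lemma mono_tens: "valid_word w \<Longrightarrow> mono w \<in> tens"
  by (auto simp: tens_def mono_def)

lemma lmul_support: "{w. lmul a f w \<noteq> 0} = (#) a ` {w. f w \<noteq> 0}"
proof (rule set_eqI)
  show "w \<in> {w. lmul a f w \<noteq> 0} \<longleftrightarrow> w \<in> (#) a ` {w. f w \<noteq> 0}" for w
    by (cases w) auto
qed

lemma lmul_tens:
  assumes "validg a" "f \<in> tens"
  shows "lmul a f \<in> tens"
proof (rule tensI)
  show "finite {w. lmul a f w \<noteq> 0}"
    unfolding lmul_support by (simp add: tensD(1) assms)
  show "valid_word w" if "lmul a f w \<noteq> 0" for w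
  proof -
    from that obtain v where "w = a # v" "f v \<noteq> 0" using lmul_support[of a f] by blast
    then show ?thesis using tensD(2)[OF assms(2), of v] assms(1) by simp
  qed
qed

lemma tens_induct [consumes 1, case_names zero add]:
  assumes "f \<in> tens" "P 0"
    and step: "\<And>c w f. valid_word w \<Longrightarrow> f \<in> tens \<Longrightarrow> P f \<Longrightarrow> P (tsmul c (mono w) + f)"
  shows "P f"
proof -
  have "finite {w. f w \<noteq> 0}" using assms(1) by (simp add: tens_def)
  then show ?thesis using assms(1)
  proof (induction "{w. f w \<noteq> 0}" arbitrary: f rule: finite_induct)
    case empty
    then have f: "f = 0" by (auto simp: fun_eq_iff)
    show ?case unfolding f by (rule assms(2))
  next
    case (insert w A)
    let ?g = "f(w := 0)"
    have A: "A = {v. ?g v \<noteq> 0}" using insert(2,4) by auto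
    have g: "?g \<in> tens" using insert(1,5) A by (auto simp: tens_def)
    have w: "valid_word w" using insert(4,5) by (auto simp: tens_def)
    have "f = tsmul (f w) (mono w) + ?g" by (auto simp: fun_eq_iff tsmul_def mono_def)
    then show ?case using step[OF w g insert(3)[OF A g]] by metis
  qed
qed

lemma tmul_tens:
  assumes "p \<in> tens" "q \<in> tens"
  shows "tmul p q \<in> tens"
  using assms(1)
proof (induction rule: tens_induct)
  case zero
  show ?case unfolding tmul_zero by (rule tens_space.subspace_0[OF subspace_tens])
next
  case (add c w f)
  have "valid_word w \<Longrightarrow> tmul (mono w) q \<in> tens"
    by (induction w) (simp_all add: tmul_mono_Nil tmul_mono_Cons lmul_tens assms)
  then have "tmul (mono w) q \<in> tens" using add(1) .
  then show ?case unfolding tmul_add tmul_smul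
    by (intro tens_space.subspace_add[OF subspace_tens] tens_space.subspace_scale[OF subspace_tens] add(3))
qed

lemma emb_simps [simp]: "emb x [] = 0" "emb x [g] = x g" "emb x (g # h # v) = 0"
  by (simp_all add: emb_def)

text \<open>\<open>brk\<close> cuts off indices below -1 and \<open>lie_comb\<close> does not. For
  valid generators such an index arises only when both indices are -1, and there the coefficient
  \<open>n - m\<close> is zero.\<close>

lemma emb_brk:
  assumes "validg a" "validg b"
  shows "emb (brk a b) = lie_comb tsmul a b (\<lambda>g. mono [g])"
proof
  fix w :: "gen list"
  consider "w = []" | g where "w = [g]" | g h v where "w = g # h # v" by (metis neq_Nil_conv)
  then show "emb (brk a b) w = lie_comb tsmul a b (\<lambda>g. mono [g]) w"
  proof cases
    case 1
    then show ?thesis by (cases a; cases b) (simp_all add: mono_def tsmul_def)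
  next
    case (2 g)
    have b: "n = -1 \<and> m = -1 \<or> -1 \<le> n + m \<and> -1 \<le> n + m + 2" if "-1 \<le> n" "-1 \<le> m" for n m :: int
      using that by auto
    show ?thesis using assms b 2
      by (cases a; cases b) (auto simp: mono_def tsmul_def validg_def bas_def)
  next
    case 3
    then show ?thesis by (cases a; cases b) (simp_all add: mono_def tsmul_def)
  qed
qed

lemma tmul_lie_comb: "tmul (lie_comb tsmul a b (\<lambda>g. mono [g])) q = lie_comb tsmul a b (\<lambda>g. lmul g q)"
proof -
  have neg: "tmul (- p) q = - tmul p q" for p :: "gen list \<Rightarrow> 'a"
    using tmul_diff[of 0 p q] by simp
  show ?thesis
    by (cases a; cases b) (simp_all add: tmul_smul tmul_diff tmul_mono_single neg)
qed

lemma tmul_lierel: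
  assumes "validg a" "validg b"
  shows "tmul (lierel a b) q = lmul a (lmul b q) - lmul b (lmul a q) - lie_comb tsmul a b (\<lambda>g. lmul g q)"
  by (simp add: lierel_def tsub_eq tmul_diff tmul_mono_pair emb_brk[OF assms] tmul_lie_comb)

lemma lie_comb_mono_tens:
  assumes "validg a" "validg b" "q \<in> tens"
  shows "lie_comb tsmul a b (\<lambda>g. lmul g q) \<in> tens"
proof -
  have b: "n = -1 \<and> m = -1 \<or> -1 \<le> n + m \<and> -1 \<le> n + m + 2" if "-1 \<le> n" "-1 \<le> m" for n m :: int
    using that by auto
  have 0: "lmul (U (n + m)) q \<in> tens" "lmul (V (n + m)) q \<in> tens" if "-1 \<le> n" "-1 \<le> m" "n \<noteq> m" for n m
    using b[OF that(1,2)] that(3) by (auto intro!: lmul_tens assms(3) simp: validg_def)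
  have 2: "lmul (U (n + m + 2)) q \<in> tens" "lmul (V (n + m + 2)) q \<in> tens" if "-1 \<le> n" "-1 \<le> m" for n m
    using b[OF that(1,2)] by (auto intro!: lmul_tens assms(3) simp: validg_def)
  show ?thesis
  proof (cases "\<exists>n. a = U n \<and> b = U n")
    case True
    then show ?thesis using tens_space.subspace_0[OF subspace_tens] by auto
  next
    case False
    then show ?thesis
      using assms(1,2) 0 2
      by (cases a; cases b)
        (auto simp: validg_def tens_space.subspace_0[OF subspace_tens] intro!: tens_space.lie_comb_in_subspace[OF subspace_tens] simp del: lie_comb.simps(1-3))
  qed
qed

lemma Jset_tens: "f \<in> Jset n \<psi> \<Longrightarrow> f \<in> tens"
proof (induction rule: Jset.induct)
  case zero
  then show ?case by (simp add: tens_def)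
next
  case (add f g)
  show ?case unfolding tadd_eq by (rule tens_space.subspace_add[OF subspace_tens add(3,4)])
next
  case (smul f c)
  show ?case by (rule tens_space.subspace_scale[OF subspace_tens smul(2)])
next
  case (lie p q a b)
  show ?case unfolding tmul_lierel[OF lie(3,4)]
    by (intro tmul_tens tens_space.subspace_diff[OF subspace_tens] lmul_tens lie_comb_mono_tens lie)
next
  case (ind p a)
  have "tsub (mono [a]) (tsmul (\<psi> a) (mono [])) \<in> tens" unfolding tsub_eq
    using ind by (intro tens_space.subspace_diff[OF subspace_tens] tens_space.subspace_scale[OF subspace_tens] mono_tens) auto
  then show ?case using ind tmul_tens by blast
qed

section \<open>Left ideals and submodules of the quotient\<close>

definition left_ideal :: "(gen list \<Rightarrow> 'k::field) set \<Rightarrow> bool" where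
  "left_ideal W \<longleftrightarrow> tens_space.subspace W \<and> W \<subseteq> tens \<and> (\<forall>a f. validg a \<longrightarrow> f \<in> W \<longrightarrow> lmul a f \<in> W)"

lemma left_idealD:
  assumes "left_ideal W"
  shows "tens_space.subspace W" "f \<in> W \<Longrightarrow> f \<in> tens" "validg a \<Longrightarrow> f \<in> W \<Longrightarrow> lmul a f \<in> W"
  using assms by (auto simp: left_ideal_def)

lemma left_ideal_Jset: "left_ideal (Jset n \<psi>)"
proof -
  have "lmul a f \<in> Jset n \<psi>" if "validg a" "f \<in> Jset n \<psi>" for a f
    using that(2)
  proof (induction rule: Jset.induct)
    case zero
    show ?case unfolding zero_fun_def[symmetric] lmul.zero by (rule Jset.zero[folded zero_fun_def])
  next
    case (add f g)
    show ?case unfolding tadd_eq lmul.add by (rule Jset.add[unfolded tadd_eq, OF add(3,4)])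
  next
    case (smul f c)
    show ?case unfolding lmul.scale by (rule Jset.smul[OF smul(2)])
  next
    case (lie p q a' b')
    show ?case using Jset.lie[OF lmul_tens[OF that(1) lie(1)] lie(2-4)] unfolding tmul_lmul .
  next
    case (ind p a')
    show ?case using Jset.ind[OF lmul_tens[OF that(1) ind(1)] ind(2,3), of \<psi>] unfolding tmul_lmul .
  qed
  moreover have "tens_space.subspace (Jset n \<psi>)"
    unfolding tens_space.subspace_def
    by (intro conjI ballI allI Jset.zero[folded zero_fun_def] Jset.add[unfolded tadd_eq] Jset.smul)
  ultimately show ?thesis by (auto simp: left_ideal_def Jset_tens)
qed

lemmas subspace_Jset = left_idealD(1)[OF left_ideal_Jset]

lemma left_ideal_eq_tens:
  assumes W: "left_ideal W" and one: "mono [] \<in> W"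
  shows "W = tens"
proof
  show "tens \<subseteq> W"
  proof
    fix f :: "gen list \<Rightarrow> 'a" assume "f \<in> tens"
    then show "f \<in> W"
    proof (induction f rule: tens_induct)
      case zero
      show ?case by (rule tens_space.subspace_0[OF left_idealD(1)[OF W]])
    next
      case (add c w f)
      have "valid_word w \<Longrightarrow> mono w \<in> W"
        by (induction w) (use one left_idealD(3)[OF W] in \<open>auto simp: mono_Cons\<close>)
      then show ?case using add left_idealD(1)[OF W]
        by (intro tens_space.subspace_add tens_space.subspace_scale) simp_all
    qed
  qed
qed (use W in \<open>auto simp: left_ideal_def\<close>)

lemma cls_eq_iff:
  assumes "f \<in> tens" "g \<in> tens"
  shows "cls n \<psi> f = cls n \<psi> g \<longleftrightarrow> f - g \<in> Jset n \<psi>"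
proof
  assume "cls n \<psi> f = cls n \<psi> g"
  moreover have "f \<in> cls n \<psi> f" using assms tens_space.subspace_0[OF subspace_Jset] by (simp add: cls_def tsub_eq)
  ultimately show "f - g \<in> Jset n \<psi>" by (simp add: cls_def tsub_eq)
next
  assume d: "f - g \<in> Jset n \<psi>"
  have "h - f \<in> Jset n \<psi> \<longleftrightarrow> h - g \<in> Jset n \<psi>" for h
  proof
    assume "h - f \<in> Jset n \<psi>"
    from tens_space.subspace_add[OF subspace_Jset this d] show "h - g \<in> Jset n \<psi>" by simp
  next
    assume "h - g \<in> Jset n \<psi>"
    from tens_space.subspace_diff[OF subspace_Jset this d] show "h - f \<in> Jset n \<psi>" by simp
  qed
  then show "cls n \<psi> f = cls n \<psi> g" by (auto simp: cls_def tsub_eq)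
qed

text \<open>Common form of \<open>smulM\<close> and \<open>actM\<close>: an operation that respects
  \<open>Jset\<close> acts on classes through representatives.\<close>

lemma cls_image:
  assumes f: "f \<in> tens" and D: "\<And>g. g \<in> tens \<Longrightarrow> g - f \<in> Jset n \<psi> \<Longrightarrow> D g - D f \<in> Jset n \<psi>"
  shows "{h \<in> tens. \<exists>g\<in>cls n \<psi> f. tsub h (D g) \<in> Jset n \<psi>} = cls n \<psi> (D f)"
proof -
  have "h - D f \<in> Jset n \<psi>" if g: "g \<in> tens" "g - f \<in> Jset n \<psi>" "h - D g \<in> Jset n \<psi>" for g h
    using tens_space.subspace_add[OF subspace_Jset g(3) D[OF g(1,2)]] by simp
  moreover have "f \<in> cls n \<psi> f" using f tens_space.subspace_0[OF subspace_Jset] by (simp add: cls_def tsub_eq)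
  ultimately show ?thesis by (auto simp: cls_def tsub_eq)
qed

lemma smulM_cls: "f \<in> tens \<Longrightarrow> smulM n \<psi> c (cls n \<psi> f) = cls n \<psi> (tsmul c f)"
  unfolding smulM_def
  by (rule cls_image) (simp_all add: tens_space.scale_right_diff_distrib[symmetric] tens_space.subspace_scale[OF subspace_Jset])

lemma actM_cls: "f \<in> tens \<Longrightarrow> validg a \<Longrightarrow> actM n \<psi> a (cls n \<psi> f) = cls n \<psi> (lmul a f)"
  unfolding actM_def tmul_mono_single
  by (rule cls_image) (simp_all add: lmul.diff[symmetric] left_idealD(3)[OF left_ideal_Jset])

lemma addM_cls:
  assumes "f \<in> tens" "g \<in> tens"
  shows "addM n \<psi> (cls n \<psi> f) (cls n \<psi> g) = cls n \<psi> (f + g)"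
proof -
  have "h - (f + g) \<in> Jset n \<psi>"
    if "f' - f \<in> Jset n \<psi>" "g' - g \<in> Jset n \<psi>" "h - (f' + g') \<in> Jset n \<psi>" for f' g' h
    using tens_space.subspace_add[OF subspace_Jset that(3) tens_space.subspace_add[OF subspace_Jset that(1,2)]]
    by (simp add: algebra_simps)
  then have "addM n \<psi> (cls n \<psi> f) (cls n \<psi> g) \<subseteq> cls n \<psi> (f + g)"
    unfolding addM_def cls_def tsub_eq tadd_eq by blast
  moreover have "f \<in> cls n \<psi> f" "g \<in> cls n \<psi> g"
    using assms tens_space.subspace_0[OF subspace_Jset] by (simp_all add: cls_def tsub_eq)
  then have "cls n \<psi> (f + g) \<subseteq> addM n \<psi> (cls n \<psi> f) (cls n \<psi> g)"
    unfolding addM_def cls_def[of n \<psi> "f + g"] tsub_eq tadd_eq by blast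
  ultimately show ?thesis by blast
qed

lemma zeroM_cls: "zeroM n \<psi> = cls n \<psi> 0"
  by (simp add: zeroM_def zero_fun_def)

text \<open>\<open>W\<close> is the preimage of \<open>S\<close> under the quotient map.\<close>

lemma submodule_left_ideal:
  assumes S: "submoduleM n \<psi> S"
  defines "W \<equiv> {f \<in> tens. cls n \<psi> f \<in> S}"
  shows "left_ideal W" "Jset n \<psi> \<subseteq> W" "S = cls n \<psi> ` W"
proof -
  note T = tens_space.subspace_0[OF subspace_tens] tens_space.subspace_add[OF subspace_tens]
    tens_space.subspace_scale[OF subspace_tens]
  have S_add: "addM n \<psi> C D \<in> S" and S_smul: "smulM n \<psi> c C \<in> S"
    and S_act: "validg a \<Longrightarrow> actM n \<psi> a C \<in> S" if "C \<in> S" "D \<in> S" for C D c a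
    using S that unfolding submoduleM_def by blast+
  have "cls n \<psi> 0 \<in> S" using S by (simp add: submoduleM_def zeroM_cls)
  then have W0: "0 \<in> W" unfolding W_def by (simp add: T(1))
  have "tens_space.subspace W"
    unfolding tens_space.subspace_def
  proof (intro conjI ballI allI W0)
    fix f g assume "f \<in> W" "g \<in> W"
    then show "f + g \<in> W"
      using S_add[of "cls n \<psi> f" "cls n \<psi> g"] unfolding W_def by (simp add: addM_cls T(2))
  next
    fix c f assume "f \<in> W"
    then show "tsmul c f \<in> W"
      using S_smul[of "cls n \<psi> f" "cls n \<psi> f"] unfolding W_def by (simp add: smulM_cls T(3))
  qed
  moreover have "lmul a f \<in> W" if "f \<in> W" "validg a" for a f
    using that S_act[of "cls n \<psi> f" "cls n \<psi> f" a] unfolding W_def by (simp add: actM_cls lmul_tens)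
  ultimately show "left_ideal W"
    by (simp add: left_ideal_def W_def subset_iff)
  show "Jset n \<psi> \<subseteq> W"
  proof
    fix f assume f: "f \<in> Jset n \<psi>"
    then have "cls n \<psi> f = cls n \<psi> 0"
      by (subst cls_eq_iff) (simp_all add: Jset_tens T(1))
    with f W0 show "f \<in> W" by (simp add: W_def Jset_tens)
  qed
  have "S \<subseteq> cls n \<psi> ` tens" using S by (simp add: submoduleM_def Mind_def)
  then show "S = cls n \<psi> ` W" unfolding W_def by blast
qed

lemma left_ideal_submodule:
  assumes W: "left_ideal W" "Jset n \<psi> \<subseteq> W"
  shows "submoduleM n \<psi> (cls n \<psi> ` W)"
    and "f \<in> tens \<Longrightarrow> cls n \<psi> f \<in> cls n \<psi> ` W \<longleftrightarrow> f \<in> W"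
proof -
  note I = left_idealD[OF W(1)]
  note W_closed = tens_space.subspace_0[OF I(1)] tens_space.subspace_add[OF I(1)]
    tens_space.subspace_scale[OF I(1)]
  show "submoduleM n \<psi> (cls n \<psi> ` W)"
    unfolding submoduleM_def Mind_def zeroM_cls
    by (intro conjI ballI allI impI)
      (auto simp: addM_cls smulM_cls actM_cls I(2) intro!: imageI W_closed I(3))
  assume f: "f \<in> tens"
  show "cls n \<psi> f \<in> cls n \<psi> ` W \<longleftrightarrow> f \<in> W"
  proof
    assume "cls n \<psi> f \<in> cls n \<psi> ` W"
    then obtain g where g: "g \<in> W" "cls n \<psi> f = cls n \<psi> g" by blast
    then have "f - g \<in> W" using cls_eq_iff[OF f] I(2) W(2) by blast
    from W_closed(2)[OF this g(1)] show "f \<in> W" by simp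
  qed simp
qed

text \<open>Submodules of the quotient correspond to left ideals containing \<open>Jset\<close>; the
  module is nonzero iff 1 is not in \<open>Jset\<close>, because a left ideal containing 1 is
  everything.\<close>

lemma irreducible_ind_iff:
  "irreducible_ind n \<psi> \<longleftrightarrow> mono [] \<notin> Jset n \<psi> \<and>
    (\<forall>W. left_ideal W \<longrightarrow> Jset n \<psi> \<subseteq> W \<longrightarrow> W = Jset n \<psi> \<or> W = tens)"
proof -
  have one: "mono [] \<in> (tens :: (gen list \<Rightarrow> 'a) set)" by (rule mono_tens) simp
  have tens: "left_ideal (tens :: (gen list \<Rightarrow> 'a) set)"
    by (simp add: left_ideal_def subspace_tens lmul_tens)
  have 0: "0 \<in> (tens :: (gen list \<Rightarrow> 'a) set)" "0 \<in> Jset n \<psi>"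
    by (rule tens_space.subspace_0[OF subspace_tens] tens_space.subspace_0[OF subspace_Jset])+
  have "cls n \<psi> f = zeroM n \<psi>" if "f \<in> Jset n \<psi>" for f
    using that cls_eq_iff[of f 0 n \<psi>] by (simp add: zeroM_cls Jset_tens 0)
  then have J: "cls n \<psi> ` Jset n \<psi> = {zeroM n \<psi>}" using 0(2) by blast
  have sub: "W \<subseteq> W'" if W: "left_ideal W" "left_ideal W'" "Jset n \<psi> \<subseteq> W'" "cls n \<psi> ` W \<subseteq> cls n \<psi> ` W'" for W W'
  proof
    fix f assume "f \<in> W"
    with W(4) have "cls n \<psi> f \<in> cls n \<psi> ` W'" by blast
    then show "f \<in> W'"
      using left_ideal_submodule(2)[OF W(2,3) left_idealD(2)[OF W(1) \<open>f \<in> W\<close>]] by simp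
  qed
  have inj: "cls n \<psi> ` W = cls n \<psi> ` W' \<longleftrightarrow> W = W'"
    if W: "left_ideal W" "Jset n \<psi> \<subseteq> W" "left_ideal W'" "Jset n \<psi> \<subseteq> W'" for W W'
  proof
    assume "cls n \<psi> ` W = cls n \<psi> ` W'"
    then show "W = W'" using sub[OF W(1,3,4)] sub[OF W(3,1,2)] by (intro equalityI) simp_all
  qed simp
  have sub_tens: "Jset n \<psi> \<subseteq> tens" using Jset_tens by blast
  have 1: "Mind n \<psi> = {zeroM n \<psi>} \<longleftrightarrow> tens = Jset n \<psi>"
    unfolding Mind_def J[symmetric] by (rule inj[OF tens sub_tens left_ideal_Jset order_refl])
  have 2: "tens = Jset n \<psi> \<longleftrightarrow> mono [] \<in> Jset n \<psi>"
  proof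
    assume "tens = Jset n \<psi>"
    with one show "mono [] \<in> Jset n \<psi>" by simp
  qed (rule left_ideal_eq_tens[OF left_ideal_Jset, symmetric])
  have 3: "(\<forall>S. submoduleM n \<psi> S \<longrightarrow> S = {zeroM n \<psi>} \<or> S = Mind n \<psi>) \<longleftrightarrow>
      (\<forall>W. left_ideal W \<longrightarrow> Jset n \<psi> \<subseteq> W \<longrightarrow> W = Jset n \<psi> \<or> W = tens)" (is "?L \<longleftrightarrow> ?R")
  proof
    assume ?L
    show ?R
    proof (intro allI impI)
      fix W assume W: "left_ideal W" "Jset n \<psi> \<subseteq> W"
      have "cls n \<psi> ` W = cls n \<psi> ` Jset n \<psi> \<or> cls n \<psi> ` W = cls n \<psi> ` tens"
        unfolding J Mind_def[symmetric] using \<open>?L\<close> left_ideal_submodule(1)[OF W] by blast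
      then show "W = Jset n \<psi> \<or> W = tens"
        unfolding inj[OF W left_ideal_Jset order_refl] inj[OF W tens sub_tens] .
    qed
  next
    assume ?R
    show ?L
    proof (intro allI impI)
      fix S assume S: "submoduleM n \<psi> S"
      obtain W where W: "left_ideal W" "Jset n \<psi> \<subseteq> W" "S = cls n \<psi> ` W"
        using submodule_left_ideal[OF S] by blast
      with \<open>?R\<close> have "W = Jset n \<psi> \<or> W = tens" by blast
      then show "S = {zeroM n \<psi>} \<or> S = Mind n \<psi>"
        unfolding W(3) J[symmetric] Mind_def by blast
    qed
  qed
  show ?thesis unfolding irreducible_ind_def 1 2 3 ..
qed

section \<open>Linear functionals on the induced module\<close>

text \<open>Generic in the index type because it serves tensors (words) as well as elements of the
  Lie algebra (generators). On infinite support the sum defaults to 0, so additivity asks for finite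
  supports.\<close>

definition lin_ext :: "('a \<Rightarrow> 'k::field) \<Rightarrow> ('a \<Rightarrow> 'k) \<Rightarrow> 'k" where
  "lin_ext \<sigma> f = (\<Sum>w | f w \<noteq> 0. f w * \<sigma> w)"

lemma lin_ext_superset: "finite A \<Longrightarrow> {w. f w \<noteq> 0} \<subseteq> A \<Longrightarrow> lin_ext \<sigma> f = (\<Sum>w\<in>A. f w * \<sigma> w)"
  unfolding lin_ext_def by (rule sum.mono_neutral_left) auto

lemma lin_ext_zero [simp]: "lin_ext \<sigma> 0 = 0"
  by (simp add: lin_ext_def)

lemma lin_ext_add:
  assumes "finite {w. f w \<noteq> 0}" "finite {w. g w \<noteq> 0}"
  shows "lin_ext \<sigma> (f + g) = lin_ext \<sigma> f + lin_ext \<sigma> g"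
proof -
  let ?A = "{w. f w \<noteq> 0} \<union> {w. g w \<noteq> 0}"
  have "lin_ext \<sigma> (f + g) = (\<Sum>w\<in>?A. (f + g) w * \<sigma> w)" "lin_ext \<sigma> f = (\<Sum>w\<in>?A. f w * \<sigma> w)"
    "lin_ext \<sigma> g = (\<Sum>w\<in>?A. g w * \<sigma> w)"
    using assms by (intro lin_ext_superset; auto)+
  then show ?thesis by (simp add: sum.distrib distrib_right)
qed

lemma lin_ext_mono: "lin_ext \<sigma> (mono w) = \<sigma> w"
proof -
  have "{v. mono w v \<noteq> (0::'a)} = {w}" by (auto simp: mono_def)
  then show ?thesis by (simp add: lin_ext_def mono_def)
qed

lemma lin_ext_cmult: "lin_ext \<sigma> (\<lambda>w. c * f w) = c * lin_ext \<sigma> f"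
  by (cases "c = 0") (simp_all add: lin_ext_def sum_distrib_left mult.assoc)

lemma lin_ext_smul: "lin_ext \<sigma> (tsmul c f) = c * lin_ext \<sigma> f"
  unfolding tsmul_def by (rule lin_ext_cmult)

lemma lin_ext_diff_left: "lin_ext (\<lambda>w. \<sigma> w - \<tau> w) f = lin_ext \<sigma> f - lin_ext \<tau> f"
  by (simp add: lin_ext_def sum_subtractf right_diff_distrib)

lemma lin_ext_cmult_left: "lin_ext (\<lambda>w. c * \<sigma> w) f = c * lin_ext \<sigma> f"
  by (simp add: lin_ext_def sum_distrib_left mult.left_commute)

lemma lin_ext_neg: "lin_ext \<sigma> (- f) = - lin_ext \<sigma> f"
  using lin_ext_cmult[of \<sigma> "-1" f] by (simp add: fun_Compl_def)

lemma lin_ext_add_tens: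
  "f \<in> tens \<Longrightarrow> g \<in> tens \<Longrightarrow> lin_ext \<sigma> (f + g) = lin_ext \<sigma> f + lin_ext \<sigma> g"
  by (intro lin_ext_add tensD)

lemma lin_ext_lmul: "lin_ext \<sigma> (lmul a f) = lin_ext (\<lambda>w. \<sigma> (a # w)) f"
  unfolding lin_ext_def lmul_support by (simp add: sum.reindex)

lemma finite_lmul: "finite {w. f w \<noteq> 0} \<Longrightarrow> finite {w. lmul a f w \<noteq> 0}"
  unfolding lmul_support by (rule finite_imageI)

lemma finite_support_closed:
  fixes f :: "'a \<Rightarrow> 'k::field"
  assumes "finite {w. f w \<noteq> 0}"
  shows "finite {w. (- f) w \<noteq> 0}" "finite {w. c * f w \<noteq> 0}"
    "finite {w. g w \<noteq> 0} \<Longrightarrow> finite {w. (f - g) w \<noteq> 0}"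
proof -
  show "finite {w. (- f) w \<noteq> 0}" "finite {w. c * f w \<noteq> 0}"
    using assms by (auto elim: finite_subset[rotated])
  assume g: "finite {w. g w \<noteq> 0}"
  have "{w. (f - g) w \<noteq> 0} \<subseteq> {w. f w \<noteq> 0} \<union> {w. g w \<noteq> 0}" by auto
  then show "finite {w. (f - g) w \<noteq> 0}" using assms g by (meson finite_UnI finite_subset)
qed

lemma lin_ext_diff:
  assumes "finite {w. f w \<noteq> 0}" "finite {w. g w \<noteq> 0}"
  shows "lin_ext \<sigma> (f - g) = lin_ext \<sigma> f - lin_ext \<sigma> g"
  unfolding diff_conv_add_uminus[of f g] lin_ext_add[OF assms(1) finite_support_closed(1)[OF assms(2)]] lin_ext_neg
  by simp

lemma lin_ext_lie_comb:
  assumes F: "\<And>g. finite {w. F g w \<noteq> 0}"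
  shows "lin_ext \<sigma> (lie_comb (\<lambda>c f w. c * f w) a b F) = lc a b (\<lambda>g. lin_ext \<sigma> (F g))"
  by (cases a; cases b)
    (simp_all add: lin_ext_diff lin_ext_neg lin_ext_cmult F finite_support_closed del: minus_apply uminus_apply)

lemma lin_ext_lc_left: "lin_ext (\<lambda>w. lc a b (\<lambda>g. \<tau> g w)) f = lc a b (\<lambda>g. lin_ext (\<tau> g) f)"
  by (cases a; cases b)
    (simp_all add: lin_ext_diff_left lin_ext_cmult_left flip: lin_ext_neg, simp_all add: lin_ext_def)

text \<open>Testing against all left factors \<open>u\<close> turns the kernel of a functional into
  a left ideal; the empty \<open>u\<close> shows that it lies in that kernel.\<close>

definition left_ideal_kernel :: "(gen list \<Rightarrow> 'k::field) \<Rightarrow> (gen list \<Rightarrow> 'k) set" where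
  "left_ideal_kernel \<sigma> = {f \<in> tens. \<forall>u. lin_ext (\<lambda>w. \<sigma> (u @ w)) f = 0}"

lemma left_ideal_left_ideal_kernel: "left_ideal (left_ideal_kernel \<sigma>)"
  unfolding left_ideal_def tens_space.subspace_def
proof (intro conjI ballI allI impI)
  show "0 \<in> left_ideal_kernel \<sigma>"
    unfolding left_ideal_kernel_def using tens_space.subspace_0[OF subspace_tens] by simp
next
  fix f g assume "f \<in> left_ideal_kernel \<sigma>" "g \<in> left_ideal_kernel \<sigma>"
  then show "f + g \<in> left_ideal_kernel \<sigma>"
    unfolding left_ideal_kernel_def
    using tens_space.subspace_add[OF subspace_tens, of f g] by (simp add: lin_ext_add_tens)
next
  fix c f assume "f \<in> left_ideal_kernel \<sigma>"
  then show "tsmul c f \<in> left_ideal_kernel \<sigma>"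
    unfolding left_ideal_kernel_def
    using tens_space.subspace_scale[OF subspace_tens, of f c] by (simp add: lin_ext_smul)
next
  show "left_ideal_kernel \<sigma> \<subseteq> tens" by (auto simp: left_ideal_kernel_def)
next
  fix a f assume a: "validg a" and f: "f \<in> left_ideal_kernel \<sigma>"
  have "lin_ext (\<lambda>w. \<sigma> (u @ a # w)) f = 0" for u
    using f[unfolded left_ideal_kernel_def, simplified, THEN conjunct2, rule_format, of "u @ [a]"] by simp
  then show "lmul a f \<in> left_ideal_kernel \<sigma>"
    using f unfolding left_ideal_kernel_def by (simp add: lmul_tens a lin_ext_lmul)
qed

lemma tmul_left_ideal:
  assumes W: "left_ideal W" and p: "p \<in> tens" and f: "f \<in> W"
  shows "tmul p f \<in> W"
  using p
proof (induction rule: tens_induct)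
  case zero
  show ?case unfolding tmul_zero by (rule tens_space.subspace_0[OF left_idealD(1)[OF W]])
next
  case (add c w q)
  have "valid_word w \<Longrightarrow> tmul (mono w) f \<in> W"
    by (induction w) (simp_all add: tmul_mono_Nil tmul_mono_Cons left_idealD(3)[OF W] f)
  then have "tmul (mono w) f \<in> W" using add(1) .
  then show ?case unfolding tmul_add tmul_smul
    by (intro tens_space.subspace_add[OF left_idealD(1)[OF W]] tens_space.subspace_scale[OF left_idealD(1)[OF W]] add(3))
qed

lemma Jset_subset_left_ideal:
  assumes W: "left_ideal W"
    and lie: "\<And>a b q. validg a \<Longrightarrow> validg b \<Longrightarrow> q \<in> tens \<Longrightarrow> tmul (lierel a b) q \<in> W"
    and ind: "\<And>a. validg a \<Longrightarrow> inF n a \<Longrightarrow> mono [a] - tsmul (\<psi> a) (mono []) \<in> W"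
  shows "Jset n \<psi> \<subseteq> W"
proof
  fix f assume "f \<in> Jset n \<psi>"
  then show "f \<in> W"
  proof (induction rule: Jset.induct)
    case zero
    show ?case by (rule tens_space.subspace_0[OF left_idealD(1)[OF W], unfolded zero_fun_def])
  next
    case (add f g)
    show ?case unfolding tadd_eq by (rule tens_space.subspace_add[OF left_idealD(1)[OF W] add(3,4)])
  next
    case (smul f c)
    show ?case by (rule tens_space.subspace_scale[OF left_idealD(1)[OF W] smul(2)])
  next
    case (lie p q a b)
    show ?case by (intro tmul_left_ideal[OF W] assms(2) lie)
  next
    case (ind p a)
    show ?case unfolding tsub_eq by (intro tmul_left_ideal[OF W] assms(3) ind)
  qed
qed

text \<open>The hypotheses say that \<open>\<sigma>\<close> vanishes on both families of generators
  of \<open>Jset\<close>: commutators with arbitrary context \<open>u\<close> and \<open>v\<close>,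
  and eigenvalue relations at the right end.\<close>

lemma Jset_subset_kernel:
  assumes comm: "\<And>u a b v. \<sigma> (u @ a # b # v) = \<sigma> (u @ b # a # v) + lc a b (\<lambda>g. \<sigma> (u @ g # v))"
    and eigen: "\<And>w a. inF n a \<Longrightarrow> \<sigma> (w @ [a]) = \<psi> a * \<sigma> w"
  shows "Jset n \<psi> \<subseteq> left_ideal_kernel \<sigma>"
proof (rule Jset_subset_left_ideal[OF left_ideal_left_ideal_kernel])
  fix a b q assume ab: "validg a" "validg b" and q: "(q :: gen list \<Rightarrow> 'a) \<in> tens"
  have fin: "finite {w. lmul g q w \<noteq> 0}" for g by (intro finite_lmul tensD q)
  have fin2: "finite {w. (lmul a (lmul b q) - lmul b (lmul a q)) w \<noteq> 0}"
    by (intro finite_support_closed finite_lmul tensD q)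
  have lc_fin: "finite {w. lie_comb tsmul a b (\<lambda>g. lmul g q) w \<noteq> 0}"
    by (intro tensD lie_comb_mono_tens ab q)
  have "lin_ext \<tau> (tmul (lierel a b) q) = 0" if \<tau>: "\<tau> = (\<lambda>w. \<sigma> (u @ w))" for u \<tau>
  proof -
    have "lin_ext \<tau> (tmul (lierel a b) q) =
      lin_ext (\<lambda>v. \<tau> (a # b # v)) q - lin_ext (\<lambda>v. \<tau> (b # a # v)) q - lc a b (\<lambda>g. lin_ext (\<lambda>v. \<tau> (g # v)) q)"
      using lin_ext_lie_comb[of "\<lambda>g. lmul g q" \<tau> a b, OF fin]
      unfolding tmul_lierel[OF ab] lin_ext_diff[OF fin2 lc_fin]
        lin_ext_diff[OF finite_lmul[OF fin] finite_lmul[OF fin]] tsmul_def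
      by (simp add: lin_ext_lmul)
    also have "\<dots> = lin_ext (\<lambda>v. \<tau> (a # b # v) - \<tau> (b # a # v) - lc a b (\<lambda>g. \<tau> (g # v))) q"
      by (simp only: lin_ext_diff_left lin_ext_lc_left)
    also have "(\<lambda>v. \<tau> (a # b # v) - \<tau> (b # a # v) - lc a b (\<lambda>g. \<tau> (g # v))) = (\<lambda>_. 0)"
      using comm[of u a b] by (simp add: \<tau>)
    finally show ?thesis by (simp add: lin_ext_def)
  qed
  moreover have "tmul (lierel a b) q \<in> tens" unfolding tmul_lierel[OF ab]
    by (intro tens_space.subspace_diff[OF subspace_tens] lmul_tens lie_comb_mono_tens ab q)
  ultimately show "tmul (lierel a b) q \<in> left_ideal_kernel \<sigma>" by (simp add: left_ideal_kernel_def)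
next
  fix a assume a: "validg a" "inF n a"
  have mem: "mono [a] \<in> tens" "tsmul (\<psi> a) (mono []) \<in> tens"
    using a by (auto intro!: tens_space.subspace_scale[OF subspace_tens] mono_tens)
  have "lin_ext (\<lambda>w. \<sigma> (u @ w)) (mono [a] - tsmul (\<psi> a) (mono [])) = 0" for u
    unfolding lin_ext_diff[OF tensD(1)[OF mem(1)] tensD(1)[OF mem(2)]]
    by (simp add: lin_ext_mono lin_ext_smul eigen[OF a(2)])
  then show "mono [a] - tsmul (\<psi> a) (mono []) \<in> left_ideal_kernel \<sigma>"
    using tens_space.subspace_diff[OF subspace_tens mem] by (simp add: left_ideal_kernel_def)
qed

section \<open>Characters of \<open>F_n\<close> and linear independence of PBW monomials\<close>

lemma finite_bas: "finite {h. bas g h \<noteq> (0::'k::field)}"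
  by (rule finite_subset[of _ "{g}"]) (auto simp: bas_def split: if_splits)

lemma lin_ext_bas: "validg g \<Longrightarrow> lin_ext \<psi> (bas g) = (\<psi> g :: 'k::field)"
proof -
  assume g: "validg g"
  then have "{h. bas g h \<noteq> (0::'k)} = {g}" by (auto simp: bas_def)
  then show ?thesis using g by (simp add: lin_ext_def bas_def)
qed

lemma lie_hom_character:
  assumes hom: "lie_hom_F n \<psi>" and ab: "inF n a" "inF n b"
  shows "lc a b \<psi> = 0"
proof -
  have valid: "validg a" "validg b" using ab by (auto simp: inF_def validg_def)
  have idx: "0 \<le> gidx a" "0 \<le> gidx b" using ab by (auto simp: inF_def)
  have brk: "brk a b = lie_comb (\<lambda>c f w. c * f w) a b (bas :: gen \<Rightarrow> gen \<Rightarrow> 'a)"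
    by (cases a; cases b) (simp_all add: fun_eq_iff)
  have "0 = lin_ext \<psi> (brk a b)"
    using hom ab valid unfolding lie_hom_F_def lin_ext_def by simp
  also have "\<dots> = lc a b (\<lambda>g. lin_ext \<psi> (bas g))"
    unfolding brk by (intro lin_ext_lie_comb finite_bas)
  also have "\<dots> = lc a b \<psi>"
    using idx by (cases a; cases b) (simp_all add: lin_ext_bas validg_def)
  finally show ?thesis by simp
qed

text \<open>Two choices of indices leave a single \<open>V\<close> in a bracket: equal indices
  remove the coefficient \<open>n - m\<close>, and \<open>U j\<close> with \<open>V (j + 1)\<close>
  removes \<open>n - m + 1\<close>. They reach even and odd \<open>k\<close> respectively.\<close>

lemma lie_hom_V_vanish:
  fixes \<psi> :: "gen \<Rightarrow> 'k::field_char_0"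
  assumes hom: "lie_hom_F n \<psi>" and k: "2 * int n < k"
  shows "\<psi> (V k) = 0"
proof (cases "even k")
  case True
  then obtain i where i: "k = 2 * i" by (rule evenE)
  have "lc (U (i - 1)) (V (i - 1)) \<psi> = 0"
    using hom by (rule lie_hom_character) (use i k in \<open>simp_all add: inF_def\<close>)
  moreover have "i - 1 + (i - 1) + 2 = k" using i by simp
  ultimately show ?thesis by simp
next
  case False
  then obtain j where j: "k = 2 * j + 1" by (rule oddE)
  have "lc (U j) (V (j + 1)) \<psi> = 0"
    using hom by (rule lie_hom_character) (use j k in \<open>simp_all add: inF_def\<close>)
  moreover have "j + (j + 1) = k" using j by simp
  ultimately show ?thesis by simp
qed

lemma key_ge_iff: "2 * int n \<le> gen_key g \<longleftrightarrow> inF n g"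
  by (cases g) (auto simp: inF_def)

lemma character_above_hom:
  assumes "lie_hom_F n \<psi>"
  shows "character_above (2 * int n) \<psi>"
  unfolding character_above_def key_ge_iff
proof (intro allI impI)
  fix a b F assume ab: "inF n a" "inF n b" and F: "\<forall>g. inF n g \<longrightarrow> F g = \<psi> g"
  have "lc a b F = lc a b \<psi>"
    using ab F by (cases a; cases b) (auto simp: inF_def)
  then show "lc a b F = 0" using lie_hom_character[OF assms ab] by simp
qed

text \<open>With \<open>\<tau>\<close> free, these functionals separate the sorted words in
  generators outside \<open>F_n\<close>: the independence half of PBW.\<close>

lemma PBW_functional:
  assumes hom: "lie_hom_F n \<psi>"
  shows "Jset n \<psi> \<subseteq> left_ideal_kernel (induced_form (2 * int n) \<psi> \<tau>)"
proof (rule Jset_subset_kernel)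
  show "induced_form (2 * int n) \<psi> \<tau> (u @ a # b # v) = induced_form (2 * int n) \<psi> \<tau> (u @ b # a # v)
    + lc a b (\<lambda>g. induced_form (2 * int n) \<psi> \<tau> (u @ g # v))" for u a b v
    unfolding induced_form_def by (rule straighten_commutator)
  show "induced_form (2 * int n) \<psi> \<tau> (w @ [a]) = \<psi> a * induced_form (2 * int n) \<psi> \<tau> w" if "inF n a" for w a
    using that by (intro induced_form_snoc character_above_hom[OF hom]) (simp add: key_ge_iff)
qed

lemma induced_form_sorted:
  assumes "sorted (map gen_key w)" "\<And>g. g \<in> set w \<Longrightarrow> gen_key g < t"
  shows "induced_form t \<psi> \<tau> w = \<tau> w"
proof -
  have "filter (\<lambda>g. gen_key g < t) w = w" "filter (\<lambda>g. t \<le> gen_key g) w = []"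
    using assms(2) by (auto simp: filter_empty_conv filter_id_conv not_le)
  then show ?thesis using assms(1) by (simp add: induced_form_def straighten_sorted)
qed

lemma left_ideal_kernelD: "f \<in> left_ideal_kernel \<sigma> \<Longrightarrow> lin_ext \<sigma> f = 0"
  unfolding left_ideal_kernel_def by (auto dest: spec[of _ "[]"])

text \<open>The functional with \<open>\<tau>\<close> constantly 1 takes the value 1 on such a
  word.\<close>

lemma PBW_notin_Jset:
  assumes hom: "lie_hom_F n \<psi>" and w: "sorted (map gen_key w)" "\<And>g. g \<in> set w \<Longrightarrow> \<not> inF n g"
  shows "mono w \<notin> Jset n \<psi>"
proof
  let ?\<sigma> = "induced_form (2 * int n) \<psi> (\<lambda>_. 1)"
  assume "mono w \<in> Jset n \<psi>"
  with PBW_functional[OF hom] have "lin_ext ?\<sigma> (mono w) = 0" by (intro left_ideal_kernelD) blast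
  moreover have "?\<sigma> w = 1"
    using w by (intro induced_form_sorted) (auto simp: key_ge_iff[symmetric] not_le)
  ultimately show False by (simp add: lin_ext_mono)
qed

text \<open>The left ideal \<open>?W\<close> of the extended character is strictly intermediate: it
  contains \<open>V (n - 1)\<close>, which is nonzero in the module, but not 1.\<close>

lemma not_irreducible_ind_if_V_zero:
  fixes \<psi> :: "gen \<Rightarrow> 'k::field_char_0"
  assumes hom: "lie_hom_F n \<psi>" and zero: "\<And>k. 2 * int n - 1 \<le> k \<Longrightarrow> int n \<le> k \<Longrightarrow> \<psi> (V k) = 0"
  shows "\<not> irreducible_ind n \<psi>"
proof
  assume irr: "irreducible_ind n \<psi>"
  let ?t = "2 * int n - 1" and ?v = "V (int n - 1)"
  define \<phi> where "\<phi> = \<psi>(?v := 0)"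
  \<comment> \<open>\<open>2 n - 1\<close> is the key of \<open>V (n - 1)\<close>.\<close>
  have key: "?t \<le> gen_key g \<longleftrightarrow> inF n g \<or> g = ?v" for g
    by (cases g) (auto simp: inF_def)
  have \<phi>V: "\<phi> (V k) = 0" if "?t \<le> k" "int n - 1 \<le> k" for k
    using zero[of k] that by (cases "k = int n - 1") (auto simp: \<phi>_def)
  have \<phi>: "\<phi> g = \<psi> g" if "inF n g" for g
    using that by (auto simp: \<phi>_def inF_def)
  have char: "character_above ?t \<phi>"
    unfolding character_above_def key
  proof (intro allI impI)
    fix a b F assume ab: "inF n a \<or> a = ?v" "inF n b \<or> b = ?v" and F: "\<forall>g. inF n g \<or> g = ?v \<longrightarrow> F g = \<phi> g"
    have FV: "F (V k) = 0" if "?t \<le> k" "int n - 1 \<le> k" for k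
      using F \<phi>V[OF that] that by (cases "k = int n - 1") (auto simp: inF_def)
    show "lc a b F = 0"
    proof (cases "\<exists>i j. a = U i \<and> b = U j")
      case True
      then obtain i j where ij: "a = U i" "b = U j" by blast
      then have inF: "inF n a" "inF n b" using ab by auto
      have "F (U k) = \<psi> (U k)" if "int n \<le> k" for k
        using F \<phi>[of "U k"] that by (simp add: inF_def)
      then have "lc a b F = lc a b \<psi>" using inF ij by (simp add: inF_def)
      then show ?thesis using lie_hom_character[OF hom inF] by simp
    next
      case False
      \<comment> \<open>Brackets of \<open>U i\<close> and \<open>V j\<close> start at index
        \<open>i + j \<ge> 2 n - 1\<close>, where \<open>\<phi>\<close> vanishes. For
        \<open>n = 0\<close> this includes \<open>V (-1)\<close> itself.\<close>
      have UV: "F (V (i + j)) = 0" "F (V (i + j + 2)) = 0" if "int n \<le> i" "int n - 1 \<le> j" for i j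
        using that by (auto intro!: FV)
      have idx: "int n \<le> i" if "U i = a \<or> U i = b" for i
        using that ab by (auto simp: inF_def)
      have idx': "int n - 1 \<le> j" if "V j = a \<or> V j = b" for j
        using that ab by (auto simp: inF_def)
      consider i j where "a = U i" "b = V j" | i j where "a = V j" "b = U i" | i j where "a = V i" "b = V j"
        using False by (metis gen.exhaust)
      then show ?thesis
        by cases (simp_all add: UV idx idx')
    qed
  qed
  let ?\<sigma> = "induced_form ?t \<phi> (\<lambda>_. 1)" and ?W = "left_ideal_kernel (induced_form ?t \<phi> (\<lambda>_. 1))"
  have eigen: "?\<sigma> (w @ [a]) = \<phi> a * ?\<sigma> w" if "inF n a \<or> a = ?v" for w a
    using that by (intro induced_form_snoc char) (simp add: key)
  have J: "Jset n \<psi> \<subseteq> ?W"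
  proof (rule Jset_subset_kernel)
    show "?\<sigma> (u @ a # b # v) = ?\<sigma> (u @ b # a # v) + lc a b (\<lambda>g. ?\<sigma> (u @ g # v))" for u a b v
      unfolding induced_form_def by (rule straighten_commutator)
    show "?\<sigma> (w @ [a]) = \<psi> a * ?\<sigma> w" if "inF n a" for w a
      using eigen[of a w] \<phi> that by simp
  qed
  \<comment> \<open>The eigenvalue of \<open>V (n - 1)\<close> is \<open>\<phi> ?v = 0\<close>, so
    every left multiple of this letter evaluates to 0.\<close>
  have v: "mono [?v] \<in> ?W"
    using eigen[of ?v] by (simp add: left_ideal_kernel_def lin_ext_mono \<phi>_def mono_tens validg_def)
  have "mono [?v] \<notin> Jset n \<psi>"
    by (rule PBW_notin_Jset[OF hom]) (simp_all add: inF_def)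
  moreover have "mono [] \<notin> ?W"
  proof
    assume "mono [] \<in> ?W"
    then have "lin_ext ?\<sigma> (mono []) = 0" by (rule left_ideal_kernelD)
    moreover have "?\<sigma> [] = 1" by (rule induced_form_sorted) simp_all
    ultimately show False by (simp add: lin_ext_mono)
  qed
  moreover have "mono [] \<in> (tens :: (gen list \<Rightarrow> 'k) set)" by (rule mono_tens) simp
  moreover have "?W = Jset n \<psi> \<or> ?W = tens"
    using irr J left_ideal_left_ideal_kernel unfolding irreducible_ind_iff by blast
  ultimately show False using v by blast
qed

section \<open>Irreducibility\<close>

text \<open>\<open>p\<close> chooses representatives of \<open>T\<close> modulo \<open>J\<close>
  linearly. It realises the quotient inside the ambient space, where the module locales can be
  instantiated.\<close>

lemma (in vector_space) projection_modulo:
  assumes J: "subspace J" and T: "subspace T" and JT: "J \<subseteq> T"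
  obtains p where "Vector_Spaces.linear scale scale p" "\<And>x. x \<in> J \<Longrightarrow> p x = 0"
    "\<And>x. p x \<in> T" "\<And>x. x \<in> T \<Longrightarrow> p x - x \<in> J"
proof -
  interpret pair: vector_space_pair scale scale by unfold_locales
  \<comment> \<open>Nested bases \<open>B\<close>, \<open>C\<close>, \<open>D\<close> of
    \<open>J\<close>, \<open>T\<close> and the whole space; \<open>p\<close> fixes
    \<open>C - B\<close> and kills the rest of \<open>D\<close>.\<close>
  obtain B where B: "B \<subseteq> J" "independent B" "J \<subseteq> span B"
    using maximal_independent_subset[of J] by metis
  obtain C where C: "B \<subseteq> C" "C \<subseteq> T" "independent C" "T \<subseteq> span C"
    using maximal_independent_subset_extend[OF order_trans[OF B(1) JT] B(2)] by metis
  obtain D where D: "C \<subseteq> D" "independent D" "UNIV \<subseteq> span D"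
    using maximal_independent_subset_extend[OF subset_UNIV C(3)] by metis
  obtain p where p: "Vector_Spaces.linear scale scale p"
    "\<And>x. x \<in> D \<Longrightarrow> p x = (if x \<in> C - B then x else 0)"
    using pair.linear_independent_extend[OF D(2), of "\<lambda>x. if x \<in> C - B then x else 0"] by blast
  interpret p: Vector_Spaces.linear scale scale p by (rule p(1))
  have on_J: "p x = 0" if "x \<in> J" for x
  proof -
    have "x \<in> span B" using B(3) that by blast
    then show ?thesis
    proof (induction rule: span_induct_alt)
      case (step c b y)
      then have "b \<in> D" using C(1) D(1) by blast
      then have "p b = 0" using step(1) by (simp add: p(2))
      then show ?case using step(2) by (simp add: p.add p.scale)
    qed (simp add: p.zero)
  qed
  have into_T: "p x \<in> T" for x
  proof -
    have "x \<in> span D" using D(3) by blast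
    then show ?thesis
    proof (induction rule: span_induct_alt)
      case (step c b y)
      have "p b \<in> T"
        unfolding p(2)[OF step(1)] using C(2) subspace_0[OF T] by (simp add: subset_iff)
      then show ?case using step(2) by (simp add: p.add p.scale subspace_add[OF T] subspace_scale[OF T])
    qed (simp add: p.zero subspace_0[OF T])
  qed
  have mod_J: "p x - x \<in> J" if "x \<in> T" for x
  proof -
    have "x \<in> span C" using C(4) that by blast
    then show ?thesis
    proof (induction rule: span_induct_alt)
      case (step c b y)
      have "b \<in> D" using step(1) D(1) by blast
      moreover have "- b \<in> J" if "b \<in> B" using B(1) that subspace_neg[OF J] by blast
      ultimately have "p b - b \<in> J"
        using step(1) subspace_0[OF J] by (simp add: p(2))
      then have "c *s (p b - b) + (p y - y) \<in> J"
        by (intro subspace_add[OF J] subspace_scale[OF J] step(2))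
      then show ?case by (simp add: p.add p.scale algebra_simps)
    qed (simp add: p.zero subspace_0[OF J])
  qed
  show ?thesis by (rule that[OF p(1) on_J into_T mod_J])
qed

lemma Jset_generators:
  "validg a \<Longrightarrow> validg b \<Longrightarrow> q \<in> tens \<Longrightarrow>
    lmul a (lmul b q) - lmul b (lmul a q) - lie_comb tsmul a b (\<lambda>g. lmul g q) \<in> Jset n \<psi>"
  "validg a \<Longrightarrow> inF n a \<Longrightarrow> mono [a] - tsmul (\<psi> a) (mono []) \<in> Jset n \<psi>"
proof -
  have one: "mono [] \<in> (tens :: (gen list \<Rightarrow> 'a) set)" by (rule mono_tens) simp
  show "lmul a (lmul b q) - lmul b (lmul a q) - lie_comb tsmul a b (\<lambda>g. lmul g q) \<in> Jset n \<psi>"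
    if "validg a" "validg b" "q \<in> tens"
    using Jset.lie[OF one that(3,1,2), of n \<psi>] by (simp add: tmul_mono_Nil tmul_lierel[OF that(1,2)])
  show "mono [a] - tsmul (\<psi> a) (mono []) \<in> Jset n \<psi>" if "validg a" "inF n a"
    using Jset.ind[OF one that, of \<psi>] by (simp add: tmul_mono_Nil tsub_eq)
qed

text \<open>A left ideal \<open>W\<close> exceeding \<open>Jset\<close> has a nonzero image under
  \<open>p\<close>. The lowering argument finds the cyclic vector there, which puts 1 into
  \<open>W\<close>.\<close>

lemma irreducible_ind_if_V_nonzero:
  fixes \<psi> :: "gen \<Rightarrow> 'k::field_char_0"
  assumes hom: "lie_hom_F n \<psi>" and m: "int n \<le> m" "2 * int n - 1 \<le> m" "\<psi> (V m) \<noteq> 0"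
    and top: "\<And>k. m < k \<Longrightarrow> \<psi> (V k) = 0"
  shows "irreducible_ind n \<psi>"
  unfolding irreducible_ind_iff
proof (intro conjI allI impI)
  show "mono [] \<notin> Jset n \<psi>" by (rule PBW_notin_Jset[OF hom]) simp_all
next
  fix W assume W: "left_ideal W" and JW: "Jset n \<psi> \<subseteq> W"
  let ?J = "Jset n \<psi>"
  obtain p where lin_p: "Vector_Spaces.linear tsmul tsmul p" and p_J: "\<And>x. x \<in> ?J \<Longrightarrow> p x = 0"
    and p_tens: "\<And>x. p x \<in> tens" and p_mod: "\<And>x. x \<in> tens \<Longrightarrow> p x - x \<in> ?J"
    using tens_space.projection_modulo[OF subspace_Jset[of n \<psi>] subspace_tens] Jset_tens by (metis subsetI)
  interpret p: Vector_Spaces.linear tsmul tsmul p by (rule lin_p)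
  have p_eq: "p x = p y" if "x - y \<in> ?J" for x y
    using p_J[OF that] by (simp add: p.diff)
  have pp: "p (p x) = p x" if "x \<in> tens" for x
    using p_eq p_mod that by blast
  have p_lmul: "p (lmul g (p x)) = p (lmul g x)" if "validg g" "x \<in> tens" for g x
    using p_eq[of "lmul g (p x)" "lmul g x"] left_idealD(3)[OF left_ideal_Jset that(1) p_mod[OF that(2)]]
    by (simp add: lmul.diff)
  \<comment> \<open>The inner \<open>p\<close> first moves any vector into \<open>tens\<close>, so
    that the module relations hold on the whole ambient space.\<close>
  define rho where "rho g x = p (lmul g (p x))" for g x
  let ?w = "p (mono [])"
  have one: "mono [] \<in> (tens :: (gen list \<Rightarrow> 'k) set)" by (rule mono_tens) simp
  have rho_p: "rho g (p x) = p (lmul g x)" if "validg g" "x \<in> tens" for g x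
    unfolding rho_def using that by (simp add: pp p_lmul)
  interpret whittaker_module tsmul rho \<psi> ?w "int n" m
  proof (intro whittaker_module.intro b_module.intro b_module_axioms.intro whittaker_module_axioms.intro
      tens_space.vector_space_axioms)
    show "Vector_Spaces.linear tsmul tsmul (rho g)" for g
      by unfold_locales (simp_all add: rho_def p.add lmul.add p.scale lmul.scale)
  next
    fix a b x assume ab: "validg a" "validg b"
    let ?q = "p x"
    have "rho a (rho b x) = p (lmul a (lmul b ?q))" if "validg a" "validg b" for a b
      using that rho_p[of a "lmul b ?q"] by (simp add: rho_def lmul_tens p_tens)
    note rr = this[OF ab] this[OF ab(2,1)]
    have "p (lmul a (lmul b ?q) - lmul b (lmul a ?q) - lie_comb tsmul a b (\<lambda>g. lmul g ?q)) = 0"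
      by (intro p_J Jset_generators ab p_tens)
    then have "p (lmul a (lmul b ?q)) = p (lmul b (lmul a ?q)) + p (lie_comb tsmul a b (\<lambda>g. lmul g ?q))"
      by (simp only: p.diff) (simp add: algebra_simps)
    moreover have "p (lie_comb tsmul a b (\<lambda>g. lmul g ?q)) = lie_comb tsmul a b (\<lambda>g. rho g x)"
      by (cases a; cases b) (simp_all only: lie_comb.simps p.diff p.scale p.neg p.zero rho_def)
    ultimately show "rho a (rho b x) = rho b (rho a x) + lie_comb tsmul a b (\<lambda>g. rho g x)"
      unfolding rr by simp
  next
    fix g assume g: "int n \<le> gidx g"
    then have "validg g" "inF n g" by (auto simp: validg_def inF_def)
    then have "p (mono [g]) = p (tsmul (\<psi> g) (mono []))" by (intro p_eq Jset_generators)
    then show "rho g ?w = tsmul (\<psi> g) ?w"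
      using rho_p[OF \<open>validg g\<close> one] by (simp add: lmul_mono p.scale)
  next
    show "lc a b \<psi> = 0" if "int n \<le> gidx a" "int n \<le> gidx b" for a b
      using that by (intro lie_hom_character[OF hom]) (simp_all add: inF_def)
  qed (use m top in simp_all)
  \<comment> \<open>\<open>U_from (-1)\<close> contains every valid generator, so the classes of all
    words are reached from \<open>?w\<close>.\<close>
  have generated: "p f \<in> M_U (-1)" if "f \<in> tens" for f
    using that
  proof (induction f rule: tens_induct)
    case zero
    show ?case unfolding p.zero by (rule tens_space.subspace_0[OF subspace_generated])
  next
    case (add c v f)
    have "valid_word v \<Longrightarrow> p (mono v) \<in> M_U (-1)"
    proof (induction v)
      case Nil
      show ?case by (rule generated.gen_base)
    next
      case (Cons g v)
      then have v: "validg g" "valid_word v" by simp_all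
      then have "p (mono (g # v)) = rho g (p (mono v))"
        using rho_p[OF v(1) mono_tens[OF v(2)]] by (simp add: mono_Cons)
      moreover have "g \<in> U_from (-1)" using v(1) by (cases g) (simp_all add: U_from_def validg_def)
      ultimately show ?case using generated.gen_act Cons.IH[OF v(2)] by metis
    qed
    then have v: "p (mono v) \<in> M_U (-1)" using add(1) .
    show ?case unfolding p.add p.scale
      by (intro generated.gen_add generated.gen_scale v add(3))
  qed
  show "W = ?J \<or> W = tens"
  proof (cases "W \<subseteq> ?J")
    case True
    then show ?thesis using JW by blast
  next
    case False
    then obtain f where f: "f \<in> W" "f \<notin> ?J" by blast
    have ft: "f \<in> tens" using left_idealD(2)[OF W f(1)] .
    have "?w \<in> p ` W"
    proof (rule submodule_contains_cyclic_vector)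
      show "tens_space.subspace (p ` W)" by (rule p.subspace_image[OF left_idealD(1)[OF W]])
      show "p f \<in> p ` W" using f(1) by (rule imageI)
      show "p f \<in> M_U (-1)" by (rule generated[OF ft])
      show "p f \<noteq> 0"
      proof
        assume "p f = 0"
        with p_mod[OF ft] have "- f \<in> ?J" by simp
        from tens_space.subspace_neg[OF subspace_Jset this] f(2) show False by simp
      qed
      fix g x assume g: "validg g" and "x \<in> p ` W"
      then obtain h where h: "h \<in> W" "x = p h" by blast
      have "rho g x = p (lmul g h)" unfolding h(2) by (rule rho_p[OF g left_idealD(2)[OF W h(1)]])
      then show "rho g x \<in> p ` W" using left_idealD(3)[OF W g h(1)] by blast
    qed
    then obtain h where h: "h \<in> W" "?w = p h" by blast
    have ht: "h \<in> tens" using left_idealD(2)[OF W h(1)] .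
    \<comment> \<open>\<open>p h = p (mono [])\<close> means that 1 and \<open>h\<close> agree
      modulo \<open>Jset\<close>.\<close>
    have "(p h - h) - (p (mono []) - mono []) \<in> ?J"
      by (intro tens_space.subspace_diff[OF subspace_Jset] p_mod ht one)
    then have "mono [] - h \<in> W" using JW h(2) by auto
    from tens_space.subspace_add[OF left_idealD(1)[OF W] this h(1)] have "mono [] \<in> W" by simp
    then show ?thesis using left_ideal_eq_tens[OF W] by blast
  qed
qed

theorem theorem6p29:
  fixes \<psi> :: "gen \<Rightarrow> 'k::field_char_0" and n :: nat
  assumes "lie_hom_F n \<psi>"
  shows "(n = 0 \<longrightarrow> (irreducible_ind n \<psi> \<longleftrightarrow> \<psi> (V 0) \<noteq> 0))
       \<and> (n \<ge> 1 \<longrightarrow> (irreducible_ind n \<psi> \<longleftrightarrow>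
              \<psi> (V (2 * int n)) \<noteq> 0 \<or> \<psi> (V (2 * int n - 1)) \<noteq> 0))"
proof (intro conjI impI)
  \<comment> \<open>\<open>\<psi>\<close> kills \<open>V k\<close> for \<open>k > 0\<close>, and
    \<open>2 n - 1 = -1\<close> lies outside \<open>F_0\<close>; only \<open>V 0\<close>
    remains.\<close>
  assume n: "n = 0"
  show "irreducible_ind n \<psi> \<longleftrightarrow> \<psi> (V 0) \<noteq> 0"
  proof
    assume "\<psi> (V 0) \<noteq> 0"
    then show "irreducible_ind n \<psi>"
      using n lie_hom_V_vanish[OF assms] by (intro irreducible_ind_if_V_nonzero[OF assms, of 0]) auto
  next
    assume irr: "irreducible_ind n \<psi>"
    show "\<psi> (V 0) \<noteq> 0"
    proof
      assume "\<psi> (V 0) = 0"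
      then have "\<psi> (V k) = 0" if "0 \<le> k" for k
        using lie_hom_V_vanish[OF assms, of k] that n by (cases "k = 0") auto
      with n irr not_irreducible_ind_if_V_zero[OF assms] show False by simp
    qed
  qed
next
  assume n: "1 \<le> n"
  show "irreducible_ind n \<psi> \<longleftrightarrow> \<psi> (V (2 * int n)) \<noteq> 0 \<or> \<psi> (V (2 * int n - 1)) \<noteq> 0"
  proof
    assume irr: "irreducible_ind n \<psi>"
    show "\<psi> (V (2 * int n)) \<noteq> 0 \<or> \<psi> (V (2 * int n - 1)) \<noteq> 0"
    proof (rule ccontr)
      assume "\<not> ?thesis"
      then have "\<psi> (V k) = 0" if "2 * int n - 1 \<le> k" for k
        using lie_hom_V_vanish[OF assms, of k] that
        by (cases "k = 2 * int n"; cases "k = 2 * int n - 1") auto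
      with irr not_irreducible_ind_if_V_zero[OF assms] show False by blast
    qed
  next
    assume nz: "\<psi> (V (2 * int n)) \<noteq> 0 \<or> \<psi> (V (2 * int n - 1)) \<noteq> 0"
    show "irreducible_ind n \<psi>"
    \<comment> \<open>The top index is \<open>2 n\<close> or \<open>2 n - 1\<close>; the latter is
      at least \<open>n\<close> because \<open>n \<ge> 1\<close>.\<close>
    proof (cases "\<psi> (V (2 * int n)) = 0")
      case False
      then show ?thesis
        using lie_hom_V_vanish[OF assms] by (intro irreducible_ind_if_V_nonzero[OF assms, of "2 * int n"]) auto
    next
      case True
      have "\<psi> (V k) = 0" if "2 * int n - 1 < k" for k
        using lie_hom_V_vanish[OF assms, of k] True that by (cases "k = 2 * int n") auto
      then show ?thesis
        using nz True n by (intro irreducible_ind_if_V_nonzero[OF assms, of "2 * int n - 1"]) auto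
    qed
  qed
qed

end
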